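(* Let $\Omega$ be a countably infinite set, let $G\leq\mathrm{Sym}(\Omega)$ be a closed permutation group and let $\alpha:G\to\mathrm{Aut}(X,\mu)$ be a Boolean p.m.p. action on a standard probability space $(X,\mu)$. Then $\alpha$ is dissociated if and only if its Koopman representation is dissociated.
   Context: $\mathrm{Sym}(\Omega)$ is the group of all permutations of the countably infinite set $\Omega$ with the topology of pointwise convergence; a closed permutation group on $\Omega$ is a closed subgroup of $\mathrm{Sym}(\Omega)$. For $A\subseteq\Omega$, $G_A=\{g\in G: g(a)=a\text{ for all }a\in A\}$. $\mathrm{Aut}(X,\mu)$ is the group of measure-preserving bijections of $(X,\mu)$, identified up to measure zero, with the weak topology ($T_n\to T$ iff $\mu(T_n(Y)\triangle T(Y))\to0$ for all measurable $Y$). A Boolean p.m.p. action is a continuous homomorphism $\alpha:G\to\mathrm{Aut}(X,\mu)$. For finite $A\subseteq\Omega$, $\mathcal{F}_A$ is the $\sigma$-algebra of measurable $Y\subseteq X$ with $\mu(\alpha(g)Y\triangle Y)=0$ for all $g\in G_A$. The action is dissociated if for all finite $A,B\subseteq\Omega$, $\mathcal{F}_A$ and $\mathcal{F}_B$ are independent conditionally on $\mathcal{F}_{A\cap B}$, i.e. $\mathbb{E}[f\mid\mathcal{F}_A]=\mathbb{E}[f\mid\mathcal{F}_{A\cap B}]$ for every $\mathcal{F}_B$-measurable $f\in L^2(X,\mu)$. The Koopman representation of $\alpha$ is the unitary representation of $G$ on the complex Hilbert space $L^2(X,\mu)$ given by $(g\cdot f)(x)=f(\alpha(g^{-1})x)$.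 A unitary representation $\pi:G\to\mathcal{U}(\mathcal{H})$ (a homomorphism with $g\mapsto\pi(g)\xi$ continuous for every $\xi$) is dissociated if $p_Ap_B=p_{A\cap B}$ for all finite $A,B\subseteq\Omega$, where $p_A$ is the orthogonal projection onto $\mathcal{H}_A=\{\xi\in\mathcal{H}:\pi(g)\xi=\xi\text{ for all }g\in G_A\}$. *)

theory Defs
  imports
    "HOL-Probability.Probability"
    "HOL-Algebra.Bij"
    "HOL-Algebra.Coset"
    "HOL-Algebra.Module"
    "HOL-Algebra.Algebraic_Closure_Type"
begin

section \<open>Closed permutation groups\<close>

text \<open>\<open>Sym(\<Omega>)\<close> is \<^const>\<open>BijGroup\<close>, whose elements are extensional; the topology of
  pointwise convergence is therefore the one induced from the product of the discrete spaces
  \<open>\<Omega>\<close>, whose points are the extensional self-maps of \<open>\<Omega>\<close>.\<close>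

definition Sym_topology :: "'w set \<Rightarrow> ('w \<Rightarrow> 'w) topology" where
  "Sym_topology \<Omega> =
     subtopology (product_topology (\<lambda>_. discrete_topology \<Omega>) \<Omega>) (carrier (BijGroup \<Omega>))"

abbreviation perm_group :: "'w set \<Rightarrow> ('w \<Rightarrow> 'w) set \<Rightarrow> ('w \<Rightarrow> 'w) monoid" where
  "perm_group \<Omega> G \<equiv> BijGroup \<Omega> \<lparr>carrier := G\<rparr>"

abbreviation perm_topology :: "'w set \<Rightarrow> ('w \<Rightarrow> 'w) set \<Rightarrow> ('w \<Rightarrow> 'w) topology" where
  "perm_topology \<Omega> G \<equiv> subtopology (Sym_topology \<Omega>) G"

definition fixator :: "('w \<Rightarrow> 'w) set \<Rightarrow> 'w set \<Rightarrow> ('w \<Rightarrow> 'w) set" where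
  "fixator G A = {g \<in> G. \<forall>a\<in>A. g a = a}"

locale closed_permutation_group =
  fixes \<Omega> :: "'w set" and G :: "('w \<Rightarrow> 'w) set"
  assumes subgroup: "subgroup G (BijGroup \<Omega>)"
    and closed: "closedin (Sym_topology \<Omega>) G"


section \<open>The group \<open>Aut(X, \<mu>)\<close>\<close>

definition standard_borel :: "'x measure \<Rightarrow> bool" where
  "standard_borel M \<longleftrightarrow>
     (\<exists>T. topspace T = space M \<and> completely_metrizable_space T \<and> second_countable T \<and>
          sets M = sigma_sets (space M) {U. openin T U})"

locale standard_prob_space = prob_space M for M :: "'x measure" +
  assumes standard: "standard_borel M"

definition mp_bijections :: "'x measure \<Rightarrow> ('x \<Rightarrow> 'x) set" where
  "mp_bijections M =
     {T \<in> Bij (space M). T \<in> measurable M M \<and> inv_into (space M) T \<in> measurable M M \<and>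
        distr M M T = M}"

definition mp_eq :: "'x measure \<Rightarrow> (('x \<Rightarrow> 'x) \<times> ('x \<Rightarrow> 'x)) set" where
  "mp_eq M = {(S, T). S \<in> mp_bijections M \<and> T \<in> mp_bijections M \<and> (AE x in M. S x = T x)}"

text \<open>The product of two classes is the class of the compositions of their members.\<close>

definition Aut :: "'x measure \<Rightarrow> ('x \<Rightarrow> 'x) set monoid" where
  "Aut M =
     \<lparr>carrier = mp_bijections M // mp_eq M,
      mult = (\<lambda>a b. mp_eq M `` {compose (space M) S T | S T. S \<in> a \<and> T \<in> b}),
      one = mp_eq M `` {\<lambda>x\<in>space M. x}\<rparr>"

definition aut_rep :: "('x \<Rightarrow> 'x) set \<Rightarrow> 'x \<Rightarrow> 'x" where
  "aut_rep a = (SOME T. T \<in> a)"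

text \<open>The image of a measurable set under an element of \<open>Aut(X, \<mu>)\<close> is only defined up to a null
  set; below it only enters through the measure of symmetric differences.\<close>

definition aut_image :: "('x \<Rightarrow> 'x) set \<Rightarrow> 'x set \<Rightarrow> 'x set" where
  "aut_image a Y = aut_rep a ` Y"

text \<open>The weak topology is the coarsest one in which all pseudometrics
  \<open>(a, b) \<mapsto> \<mu>(a(Y) \<triangle> b(Y))\<close> are continuous, so that a net \<open>a\<^sub>i\<close> converges to \<open>a\<close> iff
  \<open>\<mu>(a\<^sub>i(Y) \<triangle> a(Y))\<close> tends to \<open>0\<close> for all measurable \<open>Y\<close>.\<close>

definition weak_topology :: "'x measure \<Rightarrow> ('x \<Rightarrow> 'x) set topology" where
  "weak_topology M = topology_generated_by
     {{a \<in> carrier (Aut M). measure M (sym_diff (aut_image a Y) (aut_image b Y)) < e} | b Y e.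
        b \<in> carrier (Aut M) \<and> Y \<in> sets M \<and> 0 < e}"


section \<open>Square-integrable functions\<close>

definition square_integrable :: "'x measure \<Rightarrow> ('x \<Rightarrow> complex) \<Rightarrow> bool" where
  "square_integrable M f \<longleftrightarrow> f \<in> borel_measurable M \<and> integrable M (\<lambda>x. (cmod (f x))\<^sup>2)"

definition complex_cond_exp :: "'x measure \<Rightarrow> 'x measure \<Rightarrow> ('x \<Rightarrow> complex) \<Rightarrow> 'x \<Rightarrow> complex" where
  "complex_cond_exp M F f x =
     Complex (real_cond_exp M F (\<lambda>y. Re (f y)) x) (real_cond_exp M F (\<lambda>y. Im (f y)) x)"


section \<open>Dissociated Boolean actions\<close>

locale boolean_pmp_action = closed_permutation_group \<Omega> G + standard_prob_space M
  for \<Omega> :: "'w set" and G :: "('w \<Rightarrow> 'w) set" and M :: "'x measure" +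
  fixes \<alpha> :: "('w \<Rightarrow> 'w) \<Rightarrow> ('x \<Rightarrow> 'x) set"
  assumes hom: "\<alpha> \<in> hom (perm_group \<Omega> G) (Aut M)"
    and continuous: "continuous_map (perm_topology \<Omega> G) (weak_topology M) \<alpha>"
begin

text \<open>The generating sets already form a \<open>\<sigma>\<close>-algebra; \<^const>\<open>sigma\<close> only packages them as the
  measurable space that \<^const>\<open>real_cond_exp\<close> expects.\<close>

definition invariant_algebra :: "'w set \<Rightarrow> 'x measure" where
  "invariant_algebra A = sigma (space M)
     {Y \<in> sets M. \<forall>g \<in> fixator G A. measure M (sym_diff (aut_image (\<alpha> g) Y) Y) = 0}"

definition dissociated :: bool where
  "dissociated \<longleftrightarrow>
     (\<forall>A B f. finite A \<longrightarrow> A \<subseteq> \<Omega> \<longrightarrow> finite B \<longrightarrow> B \<subseteq> \<Omega> \<longrightarrow>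
        f \<in> borel_measurable (invariant_algebra B) \<longrightarrow> square_integrable M f \<longrightarrow>
        (AE x in M. complex_cond_exp M (invariant_algebra A) f x =
                    complex_cond_exp M (invariant_algebra (A \<inter> B)) f x))"

end


section \<open>Dissociated unitary representations\<close>

text \<open>A complex inner product space is a module record over the complex numbers together with an
  inner product. The multiplicative fields that \<^typ>\<open>('a, 'b) module\<close> inherits from rings play no
  role.\<close>

record 'v inner_space = "(complex, 'v) module" +
  ip :: "'v \<Rightarrow> 'v \<Rightarrow> complex"

text \<open>The value \<open>0\<close> off the carrier is irrelevant; it is there because \<^locale>\<open>Metric_space\<close>
  demands nonnegativity and symmetry on the whole type.\<close>

definition ip_dist :: "('v, 'm) inner_space_scheme \<Rightarrow> 'v \<Rightarrow> 'v \<Rightarrow> real" where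
  "ip_dist H u v =
     (if u \<in> carrier H \<and> v \<in> carrier H
      then sqrt (Re (ip H (u \<ominus>\<^bsub>H\<^esub> v) (u \<ominus>\<^bsub>H\<^esub> v))) else 0)"

text \<open>Inner products are linear in the first argument.\<close>

locale complex_hilbert_space = Module.module "ring_of_type_algebra :: complex ring" H
  for H :: "('v, 'm) inner_space_scheme" (structure) +
  assumes ip_add_left: "\<lbrakk>u \<in> carrier H; v \<in> carrier H; w \<in> carrier H\<rbrakk> \<Longrightarrow>
      ip H (u \<oplus>\<^bsub>H\<^esub> v) w = ip H u w + ip H v w"
    and ip_smult_left: "\<lbrakk>u \<in> carrier H; w \<in> carrier H\<rbrakk> \<Longrightarrow> ip H (c \<odot>\<^bsub>H\<^esub> u) w = c * ip H u w"
    and ip_cnj: "\<lbrakk>u \<in> carrier H; v \<in> carrier H\<rbrakk> \<Longrightarrow> ip H v u = cnj (ip H u v)"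
    and ip_pos: "\<lbrakk>u \<in> carrier H; u \<noteq> \<zero>\<^bsub>H\<^esub>\<rbrakk> \<Longrightarrow> 0 < Re (ip H u u)"
    and complete: "Metric_space.mcomplete (carrier H) (ip_dist H)"

definition unitary_group :: "('v, 'm) inner_space_scheme \<Rightarrow> ('v \<Rightarrow> 'v) monoid" where
  "unitary_group H = BijGroup (carrier H) \<lparr>carrier :=
     {U \<in> Bij (carrier H).
        (\<forall>u\<in>carrier H. \<forall>v\<in>carrier H. U (u \<oplus>\<^bsub>H\<^esub> v) = U u \<oplus>\<^bsub>H\<^esub> U v) \<and>
        (\<forall>c. \<forall>u\<in>carrier H. U (c \<odot>\<^bsub>H\<^esub> u) = c \<odot>\<^bsub>H\<^esub> U u) \<and>
        (\<forall>u\<in>carrier H. \<forall>v\<in>carrier H. ip H (U u) (U v) = ip H u v)}\<rparr>"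

definition orthogonal_projection ::
    "('v, 'm) inner_space_scheme \<Rightarrow> 'v set \<Rightarrow> 'v \<Rightarrow> 'v" where
  "orthogonal_projection H S u =
     (THE v. v \<in> S \<and> (\<forall>w\<in>S. ip H (u \<ominus>\<^bsub>H\<^esub> v) w = 0))"

locale unitary_representation = closed_permutation_group \<Omega> G + complex_hilbert_space H
  for \<Omega> :: "'w set" and G :: "('w \<Rightarrow> 'w) set" and H :: "('v, 'm) inner_space_scheme" +
  fixes \<pi> :: "('w \<Rightarrow> 'w) \<Rightarrow> 'v \<Rightarrow> 'v"
  assumes hom: "\<pi> \<in> hom (perm_group \<Omega> G) (unitary_group H)"
    and strongly_continuous: "u \<in> carrier H \<Longrightarrow>
      continuous_map (perm_topology \<Omega> G) (Metric_space.mtopology (carrier H) (ip_dist H))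
        (\<lambda>g. \<pi> g u)"
begin

definition fixed_space :: "'w set \<Rightarrow> 'v set" where
  "fixed_space A = {u \<in> carrier H. \<forall>g \<in> fixator G A. \<pi> g u = u}"

definition fixed_proj :: "'w set \<Rightarrow> 'v \<Rightarrow> 'v" where
  "fixed_proj A = orthogonal_projection H (fixed_space A)"

definition dissociated :: bool where
  "dissociated \<longleftrightarrow>
     (\<forall>A B. finite A \<longrightarrow> A \<subseteq> \<Omega> \<longrightarrow> finite B \<longrightarrow> B \<subseteq> \<Omega> \<longrightarrow>
        (\<forall>u\<in>carrier H. fixed_proj A (fixed_proj B u) = fixed_proj (A \<inter> B) u))"

end


section \<open>The Koopman representation\<close>

definition ae_eq :: "'x measure \<Rightarrow> (('x \<Rightarrow> complex) \<times> ('x \<Rightarrow> complex)) set" where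
  "ae_eq M = {(f, h). square_integrable M f \<and> square_integrable M h \<and> (AE x in M. f x = h x)}"

abbreviation L2_class :: "'x measure \<Rightarrow> ('x \<Rightarrow> complex) \<Rightarrow> ('x \<Rightarrow> complex) set" where
  "L2_class M f \<equiv> ae_eq M `` {f}"

definition L2_rep :: "('x \<Rightarrow> complex) set \<Rightarrow> 'x \<Rightarrow> complex" where
  "L2_rep u = (SOME f. f \<in> u)"

definition L2 :: "'x measure \<Rightarrow> ('x \<Rightarrow> complex) set inner_space" where
  "L2 M =
     \<lparr>carrier = {f. square_integrable M f} // ae_eq M,
      mult = undefined, one = undefined,
      zero = L2_class M (\<lambda>x. 0),
      add = (\<lambda>u v. L2_class M (\<lambda>x. L2_rep u x + L2_rep v x)),
      smult = (\<lambda>c u. L2_class M (\<lambda>x. c * L2_rep u x)),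
      ip = (\<lambda>u v. \<integral>x. L2_rep u x * cnj (L2_rep v x) \<partial>M)\<rparr>"

definition koopman ::
    "'w set \<Rightarrow> 'x measure \<Rightarrow> (('w \<Rightarrow> 'w) \<Rightarrow> ('x \<Rightarrow> 'x) set) \<Rightarrow>
     ('w \<Rightarrow> 'w) \<Rightarrow> ('x \<Rightarrow> complex) set \<Rightarrow> ('x \<Rightarrow> complex) set" where
  "koopman \<Omega> M \<alpha> g =
     (\<lambda>u\<in>carrier (L2 M). L2_class M (\<lambda>x. L2_rep u (aut_rep (\<alpha> (inv\<^bsub>BijGroup \<Omega>\<^esub> g)) x)))"

end

theory Submission
  imports Defs
begin

text \<open>
  Let \<open>F\<^sub>A\<close> be the \<open>\<sigma>\<close>-algebra of \<open>G\<^sub>A\<close>-invariant sets. A square-integrable function is fixed almost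
  everywhere by \<open>G\<^sub>A\<close> iff it is \<open>F\<^sub>A\<close>-measurable (\<open>L2_class_in_fixed_space_iff\<close>), so the space of
  \<open>G\<^sub>A\<close>-fixed vectors of the Koopman representation is \<open>L\<^sup>2(F\<^sub>A)\<close>, and the orthogonal projection
  \<open>p\<^sub>A\<close> onto it is the conditional expectation \<open>E[ _ | F\<^sub>A]\<close> (\<open>fixed_proj_class\<close>). Under this
  identification \<open>p\<^sub>A p\<^sub>B = p\<^bsub>A \<inter> B\<^esub>\<close> says that \<open>E[E[f | F\<^sub>B] | F\<^sub>A] = E[f | F\<^bsub>A \<inter> B\<^esub>]\<close> for every
  \<open>f\<close> in \<open>L\<^sup>2\<close>. As \<open>F\<^bsub>A \<inter> B\<^esub>\<close> is contained in \<open>F\<^sub>B\<close>, the tower property rewrites the right-hand side to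
  \<open>E[E[f | F\<^sub>B] | F\<^bsub>A \<inter> B\<^esub>]\<close>, and since \<open>E[f | F\<^sub>B]\<close> runs through all \<open>F\<^sub>B\<close>-measurable functions in
  \<open>L\<^sup>2\<close>, this is the definition of a dissociated action.

  Dissociation is a property of unitary representations, so the Koopman representation has to be
  shown to be one
  (\<open>unitary_representation_koopman\<close>). This takes the Riesz--Fischer theorem (\<open>L2_complete\<close>) and
  strong continuity. The latter is a statement about the pseudometrics of the weak topology
  for indicator functions, and passes to all of \<open>L\<^sup>2\<close> because simple functions are dense and
  translations are isometric.
\<close>

section \<open>Square-integrable functions and the \<open>L\<^sup>2\<close>-seminorm\<close>

lemma square_integrable_add:
  assumes "square_integrable M f" "square_integrable M h"
  shows "square_integrable M (\<lambda>x. f x + h x)"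
proof -
  have [measurable]: "f \<in> borel_measurable M" "h \<in> borel_measurable M"
    using assms by (auto simp: square_integrable_def)
  have "integrable M (\<lambda>x. 2 * (cmod (f x))\<^sup>2 + 2 * (cmod (h x))\<^sup>2)"
    using assms by (auto simp: square_integrable_def)
  moreover have "(cmod (a + b))\<^sup>2 \<le> 2 * (cmod a)\<^sup>2 + 2 * (cmod b)\<^sup>2" for a b
  proof -
    have "(cmod (a + b))\<^sup>2 \<le> (cmod a + cmod b)\<^sup>2"
      by (simp add: norm_triangle_ineq power_mono)
    also have "\<dots> \<le> 2 * (cmod a)\<^sup>2 + 2 * (cmod b)\<^sup>2"
      using sum_squares_bound[of "cmod a" "cmod b"] by (simp add: power2_sum)
    finally show ?thesis .
  qed
  ultimately show ?thesis
    unfolding square_integrable_def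
    by (auto intro!: Bochner_Integration.integrable_bound[where f = "\<lambda>x. 2 * (cmod (f x))\<^sup>2 + 2 * (cmod (h x))\<^sup>2"])
qed

lemma square_integrable_cmult:
  assumes "square_integrable M f"
  shows "square_integrable M (\<lambda>x. c * f x)"
  using assms by (auto simp: square_integrable_def norm_mult power_mult_distrib)

lemma square_integrable_minus:
  "square_integrable M f \<Longrightarrow> square_integrable M (\<lambda>x. - f x)"
  using square_integrable_cmult[of M f "-1"] by simp

lemma square_integrable_diff:
  assumes "square_integrable M f" "square_integrable M h"
  shows "square_integrable M (\<lambda>x. f x - h x)"
  using square_integrable_add[OF assms(1) square_integrable_minus[OF assms(2)]] by simp

lemma square_integrable_zero: "square_integrable M (\<lambda>x. 0)"
  by (simp add: square_integrable_def)

lemma square_integrable_bound: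
  assumes "square_integrable M f" "h \<in> borel_measurable M"
    and "AE x in M. cmod (h x) \<le> cmod (f x)"
  shows "square_integrable M h"
proof -
  have "AE x in M. norm ((cmod (h x))\<^sup>2) \<le> norm ((cmod (f x))\<^sup>2)"
    using assms(3) by eventually_elim (simp add: power_mono)
  then show ?thesis
    using assms unfolding square_integrable_def
    by (auto intro: Bochner_Integration.integrable_bound)
qed

text \<open>By \<open>\<bar>ab\<bar> \<le> \<bar>a\<bar>\<^sup>2 + \<bar>b\<bar>\<^sup>2\<close>.\<close>

lemma integrable_inner:
  assumes "square_integrable M f" "square_integrable M h"
  shows "integrable M (\<lambda>x. f x * cnj (h x))"
proof -
  have [measurable]: "f \<in> borel_measurable M" "h \<in> borel_measurable M"
    using assms by (auto simp: square_integrable_def)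
  have 1: "integrable M (\<lambda>x. (cmod (f x))\<^sup>2 + (cmod (h x))\<^sup>2)"
    using assms by (auto simp: square_integrable_def)
  have 2: "cmod (a * b) \<le> (cmod a)\<^sup>2 + (cmod b)\<^sup>2" for a b
  proof -
    have "0 \<le> cmod a * cmod b" by simp
    with sum_squares_bound[of "cmod a" "cmod b"] show ?thesis
      unfolding norm_mult by linarith
  qed
  show ?thesis
  proof (rule Bochner_Integration.integrable_bound[OF 1])
    show "(\<lambda>x. f x * cnj (h x)) \<in> borel_measurable M"
      by (intro borel_measurable_times measurable_compose[OF \<open>h \<in> borel_measurable M\<close>]
          borel_measurable_continuous_onI continuous_intros) simp
    show "AE x in M. cmod (f x * cnj (h x)) \<le> norm ((cmod (f x))\<^sup>2 + (cmod (h x))\<^sup>2)"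
      using 2[of "f _" "cnj (h _)"] by simp
  qed
qed

lemma (in finite_measure) square_integrable_imp_integrable:
  assumes "square_integrable M f"
  shows "integrable M f"
proof -
  have "square_integrable M (\<lambda>x. 1)"
    by (simp add: square_integrable_def)
  from integrable_inner[OF assms this] show ?thesis by simp
qed

definition L2_norm :: "'x measure \<Rightarrow> ('x \<Rightarrow> complex) \<Rightarrow> real" where
  "L2_norm M f = sqrt (\<integral>x. (cmod (f x))\<^sup>2 \<partial>M)"

lemma L2_norm_nonneg: "0 \<le> L2_norm M f"
  by (simp add: L2_norm_def)

lemma L2_norm_power2: "(L2_norm M f)\<^sup>2 = (\<integral>x. (cmod (f x))\<^sup>2 \<partial>M)"
  by (simp add: L2_norm_def)

lemma L2_norm_cong_AE:
  assumes "f \<in> borel_measurable M" "h \<in> borel_measurable M" "AE x in M. f x = h x"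
  shows "L2_norm M f = L2_norm M h"
proof -
  have "(\<integral>x. (cmod (f x))\<^sup>2 \<partial>M) = (\<integral>x. (cmod (h x))\<^sup>2 \<partial>M)"
    using assms by (intro integral_cong_AE) auto
  then show ?thesis by (simp add: L2_norm_def)
qed

lemma L2_norm_eq_0_iff:
  assumes "square_integrable M f"
  shows "L2_norm M f = 0 \<longleftrightarrow> (AE x in M. f x = 0)"
  using assms integral_nonneg_eq_0_iff_AE[of M "\<lambda>x. (cmod (f x))\<^sup>2"]
  by (simp add: L2_norm_def square_integrable_def)

lemma L2_norm_cmult: "L2_norm M (\<lambda>x. c * f x) = cmod c * L2_norm M f"
  by (simp add: L2_norm_def norm_mult power_mult_distrib real_sqrt_mult)

lemma L2_norm_minus_commute: "L2_norm M (\<lambda>x. f x - h x) = L2_norm M (\<lambda>x. h x - f x)"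
  by (simp add: L2_norm_def norm_minus_commute)

text \<open>Integrating \<open>\<bar>u + v\<bar>\<^sup>2 \<le> (1 + t) \<bar>u\<bar>\<^sup>2 + (1 + 1/t) \<bar>v\<bar>\<^sup>2\<close> and taking for \<open>t\<close> the quotient of the
  two norms gives Minkowski's inequality without the Cauchy-Schwarz inequality.\<close>

lemma L2_norm_triangle:
  assumes f: "square_integrable M f" and h: "square_integrable M h"
  shows "L2_norm M (\<lambda>x. f x + h x) \<le> L2_norm M f + L2_norm M h"
proof -
  define a b where "a = L2_norm M f" and "b = L2_norm M h"
  have [measurable]: "f \<in> borel_measurable M" "h \<in> borel_measurable M"
    using assms by (auto simp: square_integrable_def)
  have ab: "0 \<le> a" "0 \<le> b" by (auto simp: a_def b_def L2_norm_nonneg)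
  consider "a = 0" | "b = 0" | "0 < a" "0 < b" using ab by linarith
  then show ?thesis
  proof cases
    case 1
    then have "AE x in M. f x = 0" using L2_norm_eq_0_iff[OF f] by (simp add: a_def)
    then have "L2_norm M (\<lambda>x. f x + h x) = L2_norm M h"
      by (intro L2_norm_cong_AE) auto
    then show ?thesis using 1 by (simp add: a_def)
  next
    case 2
    then have "AE x in M. h x = 0" using L2_norm_eq_0_iff[OF h] by (simp add: b_def)
    then have "L2_norm M (\<lambda>x. f x + h x) = L2_norm M f"
      by (intro L2_norm_cong_AE) auto
    then show ?thesis using 2 by (simp add: b_def)
  next
    case 3
    have pt: "(cmod (u + v))\<^sup>2 \<le> (1 + b / a) * (cmod u)\<^sup>2 + (1 + a / b) * (cmod v)\<^sup>2" for u v
    proof -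
      have "(cmod (u + v))\<^sup>2 \<le> (cmod u + cmod v)\<^sup>2"
        by (simp add: norm_triangle_ineq power_mono)
      also have "\<dots> = (cmod u)\<^sup>2 + (cmod v)\<^sup>2 + 2 * cmod u * cmod v"
        by (simp add: power2_sum)
      also have "2 * cmod u * cmod v \<le> (b / a) * (cmod u)\<^sup>2 + (a / b) * (cmod v)\<^sup>2"
      proof -
        have "2 * (b * cmod u) * (a * cmod v) \<le> (b * cmod u)\<^sup>2 + (a * cmod v)\<^sup>2"
          by (rule sum_squares_bound)
        then have "2 * (b * cmod u) * (a * cmod v) / (a * b) \<le> ((b * cmod u)\<^sup>2 + (a * cmod v)\<^sup>2) / (a * b)"
          using 3 by (intro divide_right_mono) auto
        then show ?thesis
          using 3 by (simp add: add_divide_distrib power_mult_distrib power2_eq_square mult_ac)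
      qed
      finally show ?thesis by (simp add: algebra_simps)
    qed
    have "(\<integral>x. (cmod (f x + h x))\<^sup>2 \<partial>M) \<le>
        (\<integral>x. (1 + b / a) * (cmod (f x))\<^sup>2 + (1 + a / b) * (cmod (h x))\<^sup>2 \<partial>M)"
      using pt assms square_integrable_add[OF assms]
      by (intro integral_mono) (auto simp: square_integrable_def)
    also have "\<dots> = (1 + b / a) * a\<^sup>2 + (1 + a / b) * b\<^sup>2"
      using assms by (simp add: square_integrable_def a_def b_def L2_norm_power2)
    also have "\<dots> = (a + b)\<^sup>2"
      using 3 by (simp add: distrib_right power2_sum) (simp add: power2_eq_square)
    finally have "L2_norm M (\<lambda>x. f x + h x) \<le> sqrt ((a + b)\<^sup>2)"
      unfolding L2_norm_def by (rule real_sqrt_le_mono)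
    then show ?thesis using ab by (simp add: a_def b_def)
  qed
qed

text \<open>On a probability space the \<open>L\<^sup>1\<close>-norm is at most the \<open>L\<^sup>2\<close>-norm because variances are
  nonnegative.\<close>

lemma (in prob_space) integral_norm_le_L2_norm:
  assumes "square_integrable M f"
  shows "(\<integral>x. cmod (f x) \<partial>M) \<le> L2_norm M f"
proof -
  have i: "integrable M (\<lambda>x. cmod (f x))" "integrable M (\<lambda>x. (cmod (f x))\<^sup>2)"
    using square_integrable_imp_integrable[OF assms] assms by (auto simp: square_integrable_def)
  have "0 \<le> variance (\<lambda>x. cmod (f x))"
    by (rule integral_nonneg_AE) simp
  then have "(\<integral>x. cmod (f x) \<partial>M)\<^sup>2 \<le> (\<integral>x. (cmod (f x))\<^sup>2 \<partial>M)"
    using variance_eq[OF i] by simp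
  then show ?thesis
    unfolding L2_norm_def by (rule real_le_rsqrt)
qed

text \<open>Riesz--Fischer: an \<open>L\<^sup>2\<close>-Cauchy sequence is \<open>L\<^sup>1\<close>-Cauchy, so a subsequence converges almost
  everywhere, and Fatou's lemma turns the Cauchy estimate into one for the distance to the
  pointwise limit.\<close>

lemma (in prob_space) L2_complete:
  assumes s: "\<And>n. square_integrable M (s n)"
    and cauchy: "\<And>e. 0 < e \<Longrightarrow> \<exists>N. \<forall>m\<ge>N. \<forall>n\<ge>N. L2_norm M (\<lambda>x. s m x - s n x) < e"
  shows "\<exists>f. square_integrable M f \<and> (\<lambda>n. L2_norm M (\<lambda>x. s n x - f x)) \<longlonglongrightarrow> 0"
proof -
  have [measurable]: "s n \<in> borel_measurable M" for n
    using s by (auto simp: square_integrable_def)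
  have "\<exists>N. \<forall>i\<ge>N. \<forall>j\<ge>N. (\<integral>x. norm (s i x - s j x) \<partial>M) < e" if "0 < e" for e
    using cauchy[OF that] integral_norm_le_L2_norm[OF square_integrable_diff[OF s s]]
    by (meson le_less_trans)
  with cauchy_L1_AE_cauchy_subseq[of M s] square_integrable_imp_integrable[OF s]
  obtain r where r: "strict_mono r" "AE x in M. Cauchy (\<lambda>i. s (r i) x)" by blast
  define f where "f = (\<lambda>x. lim (\<lambda>i. s (r i) x))"
  have [measurable]: "f \<in> borel_measurable M" unfolding f_def by measurable
  have conv: "AE x in M. (\<lambda>i. s (r i) x) \<longlonglongrightarrow> f x"
    using r(2) by eventually_elim (simp add: f_def Cauchy_convergent_iff convergent_LIMSEQ_iff)
  have key: "square_integrable M (\<lambda>x. s n x - f x) \<and> L2_norm M (\<lambda>x. s n x - f x) \<le> e"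
    if "0 < e" and N: "\<And>m n. N \<le> m \<Longrightarrow> N \<le> n \<Longrightarrow> L2_norm M (\<lambda>x. s m x - s n x) < e" and "N \<le> n"
    for e N n
  proof -
    have "(\<integral>\<^sup>+x. ennreal ((cmod (s n x - f x))\<^sup>2) \<partial>M)
        = (\<integral>\<^sup>+x. liminf (\<lambda>i. ennreal ((cmod (s n x - s (r i) x))\<^sup>2)) \<partial>M)"
    proof (rule nn_integral_cong_AE)
      show "AE x in M. ennreal ((cmod (s n x - f x))\<^sup>2)
          = liminf (\<lambda>i. ennreal ((cmod (s n x - s (r i) x))\<^sup>2))"
        using conv
      proof eventually_elim
        case (elim x)
        then have "(\<lambda>i. ennreal ((cmod (s n x - s (r i) x))\<^sup>2)) \<longlonglongrightarrow> ennreal ((cmod (s n x - f x))\<^sup>2)"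
          by (intro tendsto_intros)
        then show ?case by (metis lim_imp_Liminf sequentially_bot)
      qed
    qed
    also have "\<dots> \<le> liminf (\<lambda>i. \<integral>\<^sup>+x. ennreal ((cmod (s n x - s (r i) x))\<^sup>2) \<partial>M)"
      by (rule nn_integral_liminf) measurable
    also have "\<dots> \<le> ennreal (e\<^sup>2)"
    proof (rule Liminf_le)
      show "\<forall>\<^sub>F i in sequentially. (\<integral>\<^sup>+x. ennreal ((cmod (s n x - s (r i) x))\<^sup>2) \<partial>M) \<le> ennreal (e\<^sup>2)"
      proof (rule eventually_sequentiallyI[of N])
        fix i assume "N \<le> i"
        with r(1) have "N \<le> r i" using seq_suble le_trans by blast
        then have "(L2_norm M (\<lambda>x. s n x - s (r i) x))\<^sup>2 \<le> e\<^sup>2"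
          using N \<open>N \<le> n\<close> by (intro power_mono) (auto simp: L2_norm_nonneg less_imp_le)
        moreover have "(\<integral>\<^sup>+x. ennreal ((cmod (s n x - s (r i) x))\<^sup>2) \<partial>M)
            = ennreal ((L2_norm M (\<lambda>x. s n x - s (r i) x))\<^sup>2)"
          using square_integrable_diff[OF s s] unfolding L2_norm_power2
          by (intro nn_integral_eq_integral) (auto simp: square_integrable_def)
        ultimately show "(\<integral>\<^sup>+x. ennreal ((cmod (s n x - s (r i) x))\<^sup>2) \<partial>M) \<le> ennreal (e\<^sup>2)"
          by (simp add: ennreal_leI)
      qed
    qed simp
    finally have le: "(\<integral>\<^sup>+x. ennreal ((cmod (s n x - f x))\<^sup>2) \<partial>M) \<le> ennreal (e\<^sup>2)" .
    then have "integrable M (\<lambda>x. (cmod (s n x - f x))\<^sup>2)"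
      by (intro integrableI_bounded) (auto simp: le_less_trans[OF _ ennreal_less_top])
    moreover from this le have "(\<integral>x. (cmod (s n x - f x))\<^sup>2 \<partial>M) \<le> e\<^sup>2"
      by (subst (asm) nn_integral_eq_integral) auto
    ultimately show ?thesis
      using that(1) by (auto simp: square_integrable_def L2_norm_def intro!: real_le_lsqrt)
  qed
  have "square_integrable M f"
  proof -
    obtain N where "\<And>m n. N \<le> m \<Longrightarrow> N \<le> n \<Longrightarrow> L2_norm M (\<lambda>x. s m x - s n x) < 1"
      using cauchy[of 1] by auto
    then have "square_integrable M (\<lambda>x. s N x - f x)" using key[of 1 N N] by simp
    from square_integrable_diff[OF s[of N] this] show ?thesis by simp
  qed
  moreover have "(\<lambda>n. L2_norm M (\<lambda>x. s n x - f x)) \<longlonglongrightarrow> 0"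
  proof (rule LIMSEQ_I)
    fix e :: real assume "0 < e"
    then obtain N where "\<And>m n. N \<le> m \<Longrightarrow> N \<le> n \<Longrightarrow> L2_norm M (\<lambda>x. s m x - s n x) < e / 2"
      using cauchy[of "e / 2"] by auto
    then have "L2_norm M (\<lambda>x. s n x - f x) \<le> e / 2" if "N \<le> n" for n
      using key[of "e / 2" N n] that \<open>0 < e\<close> by simp
    then show "\<exists>N. \<forall>n\<ge>N. norm (L2_norm M (\<lambda>x. s n x - f x) - 0) < e"
      using \<open>0 < e\<close> by (intro exI[of _ N]) (force simp: L2_norm_nonneg)
  qed
  ultimately show ?thesis by blast
qed

section \<open>The Hilbert space \<open>L\<^sup>2\<close> of a probability space\<close>

text \<open>The record \<^const>\<open>L2\<close> is defined through \<^const>\<open>L2_rep\<close>, an arbitrary choice of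
  representatives. Different choices agree almost everywhere, so each operation can be computed on
  any representatives; the lemmas \<open>L2_add_class\<close>, \<open>L2_smult_class\<close>, \<open>L2_ip_class\<close> and
  \<open>ip_dist_L2_class\<close> say this, and from then on the choice does not matter.\<close>

lemma equiv_ae_eq: "equiv {f. square_integrable M f} (ae_eq M)"
proof (rule equivI)
  show "ae_eq M \<subseteq> {f. square_integrable M f} \<times> {f. square_integrable M f}"
    by (auto simp: ae_eq_def)
  show "refl_on {f. square_integrable M f} (ae_eq M)"
    by (auto simp: refl_on_def ae_eq_def)
  show "sym (ae_eq M)"
    by (auto simp: sym_def ae_eq_def elim: eventually_mono)
  show "trans (ae_eq M)"
  proof (rule transI)
    fix f h k assume fh: "(f, h) \<in> ae_eq M" "(h, k) \<in> ae_eq M"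
    then have "AE x in M. f x = h x" "AE x in M. h x = k x" by (auto simp: ae_eq_def)
    then have "AE x in M. f x = k x" by eventually_elim simp
    with fh show "(f, k) \<in> ae_eq M" by (auto simp: ae_eq_def)
  qed
qed

lemma L2_class_in_carrier: "square_integrable M f \<Longrightarrow> L2_class M f \<in> carrier (L2 M)"
  by (auto simp: L2_def intro: quotientI)

lemma L2_carrierE:
  assumes "u \<in> carrier (L2 M)"
  obtains f where "square_integrable M f" "u = L2_class M f"
  using assms by (auto simp: L2_def elim: quotientE)

lemma L2_class_eq_iff:
  assumes "square_integrable M f" "square_integrable M h"
  shows "L2_class M f = L2_class M h \<longleftrightarrow> (AE x in M. f x = h x)"
  using eq_equiv_class_iff[OF equiv_ae_eq] assms by (auto simp: ae_eq_def)

lemma L2_rep_class: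
  assumes "square_integrable M f"
  shows "square_integrable M (L2_rep (L2_class M f))"
    and "AE x in M. L2_rep (L2_class M f) x = f x"
proof -
  have "f \<in> L2_class M f" using assms by (auto simp: ae_eq_def)
  then have "L2_rep (L2_class M f) \<in> L2_class M f"
    unfolding L2_rep_def by (rule someI[of "\<lambda>h. h \<in> L2_class M f"])
  then have "(f, L2_rep (L2_class M f)) \<in> ae_eq M" by simp
  then have "square_integrable M (L2_rep (L2_class M f)) \<and> (AE x in M. f x = L2_rep (L2_class M f) x)"
    unfolding ae_eq_def by blast
  then show "square_integrable M (L2_rep (L2_class M f))"
    and "AE x in M. L2_rep (L2_class M f) x = f x"
    by (auto elim: eventually_mono)
qed

lemma L2_rep_in_carrier:
  assumes "u \<in> carrier (L2 M)"
  shows "square_integrable M (L2_rep u)" and "L2_class M (L2_rep u) = u"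
proof -
  obtain f where f: "square_integrable M f" "u = L2_class M f" by (rule L2_carrierE[OF assms])
  then show "square_integrable M (L2_rep u)" by (simp add: L2_rep_class)
  with f show "L2_class M (L2_rep u) = u"
    using L2_rep_class[OF f(1)] L2_class_eq_iff by blast
qed

lemma L2_zero: "\<zero>\<^bsub>L2 M\<^esub> = L2_class M (\<lambda>x. 0)"
  by (simp add: L2_def)

lemma L2_add_class:
  assumes "square_integrable M f" "square_integrable M h"
  shows "L2_class M f \<oplus>\<^bsub>L2 M\<^esub> L2_class M h = L2_class M (\<lambda>x. f x + h x)"
proof -
  have "AE x in M. L2_rep (L2_class M f) x + L2_rep (L2_class M h) x = f x + h x"
    using L2_rep_class(2)[OF assms(1)] L2_rep_class(2)[OF assms(2)] by eventually_elim simp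
  moreover have "square_integrable M (\<lambda>x. L2_rep (L2_class M f) x + L2_rep (L2_class M h) x)"
    by (intro square_integrable_add L2_rep_class assms)
  ultimately show ?thesis
    using L2_class_eq_iff[THEN iffD2] square_integrable_add[OF assms] unfolding L2_def by simp
qed

lemma L2_smult_class:
  assumes "square_integrable M f"
  shows "c \<odot>\<^bsub>L2 M\<^esub> L2_class M f = L2_class M (\<lambda>x. c * f x)"
proof -
  have "AE x in M. c * L2_rep (L2_class M f) x = c * f x"
    using L2_rep_class(2)[OF assms(1)] by eventually_elim simp
  moreover have "square_integrable M (\<lambda>x. c * L2_rep (L2_class M f) x)"
    by (intro square_integrable_cmult L2_rep_class assms)
  ultimately show ?thesis
    using square_integrable_cmult[OF assms] unfolding L2_def by (simp add: L2_class_eq_iff)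
qed

lemma L2_ip_class:
  assumes "square_integrable M f" "square_integrable M h"
  shows "ip (L2 M) (L2_class M f) (L2_class M h) = (\<integral>x. f x * cnj (h x) \<partial>M)"
proof -
  have "AE x in M. L2_rep (L2_class M f) x * cnj (L2_rep (L2_class M h) x) = f x * cnj (h x)"
    using L2_rep_class(2)[OF assms(1)] L2_rep_class(2)[OF assms(2)] by eventually_elim simp
  then show ?thesis
    using L2_rep_class(1)[OF assms(1)] L2_rep_class(1)[OF assms(2)] assms
    unfolding L2_def inner_space.simps
    by (intro integral_cong_AE borel_measurable_integrable integrable_inner)
qed

lemma L2_ip_self:
  assumes "square_integrable M f"
  shows "ip (L2 M) (L2_class M f) (L2_class M f) = complex_of_real ((L2_norm M f)\<^sup>2)"
proof -
  have "ip (L2 M) (L2_class M f) (L2_class M f) = (\<integral>x. complex_of_real ((cmod (f x))\<^sup>2) \<partial>M)"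
    unfolding L2_ip_class[OF assms assms] by (simp only: complex_norm_square)
  then show ?thesis by (simp only: L2_norm_power2 integral_complex_of_real)
qed

lemma module_L2: "Module.module (ring_of_type_algebra :: complex ring) (L2 M)"
proof (rule Module.moduleI)
  show "cring (ring_of_type_algebra :: complex ring)" by (rule cring_from_type_algebra)
  show "abelian_group (L2 M)"
  proof (rule abelian_groupI)
    fix u assume u: "u \<in> carrier (L2 M)"
    then obtain f where f: "square_integrable M f" "u = L2_class M f" by (rule L2_carrierE)
    show "\<zero>\<^bsub>L2 M\<^esub> \<oplus>\<^bsub>L2 M\<^esub> u = u"
      using f by (simp add: L2_zero L2_add_class square_integrable_zero)
    show "\<exists>v\<in>carrier (L2 M). v \<oplus>\<^bsub>L2 M\<^esub> u = \<zero>\<^bsub>L2 M\<^esub>"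
      using f by (intro bexI[of _ "L2_class M (\<lambda>x. - f x)"])
        (simp_all add: L2_zero L2_add_class square_integrable_minus L2_class_in_carrier)
    fix v assume "v \<in> carrier (L2 M)"
    then obtain h where h: "square_integrable M h" "v = L2_class M h" by (rule L2_carrierE)
    show "u \<oplus>\<^bsub>L2 M\<^esub> v \<in> carrier (L2 M)"
      using f h by (simp add: L2_add_class L2_class_in_carrier square_integrable_add)
    show "u \<oplus>\<^bsub>L2 M\<^esub> v = v \<oplus>\<^bsub>L2 M\<^esub> u"
      using f h by (simp add: L2_add_class add.commute)
    fix w assume "w \<in> carrier (L2 M)"
    then obtain k where k: "square_integrable M k" "w = L2_class M k" by (rule L2_carrierE)
    show "(u \<oplus>\<^bsub>L2 M\<^esub> v) \<oplus>\<^bsub>L2 M\<^esub> w = u \<oplus>\<^bsub>L2 M\<^esub> (v \<oplus>\<^bsub>L2 M\<^esub> w)"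
      using f h k by (simp add: L2_add_class square_integrable_add add.assoc)
  qed (simp add: L2_zero L2_class_in_carrier square_integrable_zero)
next
  fix a b :: complex and u v assume u: "u \<in> carrier (L2 M)"
  then obtain f where f: "square_integrable M f" "u = L2_class M f" by (rule L2_carrierE)
  show "a \<odot>\<^bsub>L2 M\<^esub> u \<in> carrier (L2 M)"
    using f by (simp add: L2_smult_class L2_class_in_carrier square_integrable_cmult)
  show "(a \<oplus>\<^bsub>ring_of_type_algebra\<^esub> b) \<odot>\<^bsub>L2 M\<^esub> u = a \<odot>\<^bsub>L2 M\<^esub> u \<oplus>\<^bsub>L2 M\<^esub> b \<odot>\<^bsub>L2 M\<^esub> u"
    using f by (simp add: ring_of_type_algebra_def L2_smult_class L2_add_class
        square_integrable_cmult distrib_right)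
  show "(a \<otimes>\<^bsub>ring_of_type_algebra\<^esub> b) \<odot>\<^bsub>L2 M\<^esub> u = a \<odot>\<^bsub>L2 M\<^esub> (b \<odot>\<^bsub>L2 M\<^esub> u)"
    using f by (simp add: ring_of_type_algebra_def L2_smult_class square_integrable_cmult mult.assoc)
  show "\<one>\<^bsub>ring_of_type_algebra\<^esub> \<odot>\<^bsub>L2 M\<^esub> u = u"
    using f by (simp add: ring_of_type_algebra_def L2_smult_class)
  assume "v \<in> carrier (L2 M)"
  then obtain h where h: "square_integrable M h" "v = L2_class M h" by (rule L2_carrierE)
  show "a \<odot>\<^bsub>L2 M\<^esub> (u \<oplus>\<^bsub>L2 M\<^esub> v) = a \<odot>\<^bsub>L2 M\<^esub> u \<oplus>\<^bsub>L2 M\<^esub> a \<odot>\<^bsub>L2 M\<^esub> v"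
    using f h by (simp add: L2_smult_class L2_add_class square_integrable_cmult
        square_integrable_add distrib_left)
qed

lemma L2_minus_class:
  assumes f: "square_integrable M f" and h: "square_integrable M h"
  shows "L2_class M f \<ominus>\<^bsub>L2 M\<^esub> L2_class M h = L2_class M (\<lambda>x. f x - h x)"
proof -
  interpret Module.module "ring_of_type_algebra :: complex ring" "L2 M" by (rule module_L2)
  have "\<ominus>\<^bsub>L2 M\<^esub> L2_class M h = L2_class M (\<lambda>x. - h x)"
    using h by (intro M.minus_equality)
      (simp_all add: L2_zero L2_add_class square_integrable_minus L2_class_in_carrier)
  then show ?thesis
    using f h by (simp add: a_minus_def L2_add_class square_integrable_minus)
qed

lemma ip_dist_L2_class:
  assumes f: "square_integrable M f" and h: "square_integrable M h"
  shows "ip_dist (L2 M) (L2_class M f) (L2_class M h) = L2_norm M (\<lambda>x. f x - h x)"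
  using f h by (simp add: ip_dist_def L2_class_in_carrier L2_minus_class L2_ip_self
      square_integrable_diff L2_norm_nonneg flip: of_real_power)

lemma Metric_space_L2: "Metric_space (carrier (L2 M)) (ip_dist (L2 M))"
proof
  fix u v :: "('a \<Rightarrow> complex) set"
  show "0 \<le> ip_dist (L2 M) u v"
  proof (cases "u \<in> carrier (L2 M) \<and> v \<in> carrier (L2 M)")
    case True
    then obtain f h where "square_integrable M f" "u = L2_class M f"
      "square_integrable M h" "v = L2_class M h" by (metis L2_carrierE)
    then show ?thesis by (simp add: ip_dist_L2_class L2_norm_nonneg)
  qed (auto simp: ip_dist_def)
  show "ip_dist (L2 M) u v = ip_dist (L2 M) v u"
  proof (cases "u \<in> carrier (L2 M) \<and> v \<in> carrier (L2 M)")
    case True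
    then obtain f h where "square_integrable M f" "u = L2_class M f"
      "square_integrable M h" "v = L2_class M h" by (metis L2_carrierE)
    then show ?thesis by (simp add: ip_dist_L2_class L2_norm_minus_commute[of M f h])
  qed (auto simp: ip_dist_def)
next
  fix u v :: "('a \<Rightarrow> complex) set"
  assume u: "u \<in> carrier (L2 M)" and v: "v \<in> carrier (L2 M)"
  obtain f where f: "square_integrable M f" "u = L2_class M f" by (rule L2_carrierE[OF u])
  obtain h where h: "square_integrable M h" "v = L2_class M h" by (rule L2_carrierE[OF v])
  show "ip_dist (L2 M) u v = 0 \<longleftrightarrow> u = v"
    using f h by (simp add: ip_dist_L2_class L2_norm_eq_0_iff square_integrable_diff L2_class_eq_iff)
  fix w assume w: "w \<in> carrier (L2 M)"
  obtain k where k: "square_integrable M k" "w = L2_class M k" by (rule L2_carrierE[OF w])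
  show "ip_dist (L2 M) u w \<le> ip_dist (L2 M) u v + ip_dist (L2 M) v w"
    using f h k L2_norm_triangle[OF square_integrable_diff[OF f(1) h(1)] square_integrable_diff[OF h(1) k(1)]]
    by (simp add: ip_dist_L2_class)
qed

lemma (in prob_space) mcomplete_L2: "Metric_space.mcomplete (carrier (L2 M)) (ip_dist (L2 M))"
proof -
  interpret L: Metric_space "carrier (L2 M)" "ip_dist (L2 M)" by (rule Metric_space_L2)
  show ?thesis
    unfolding L.mcomplete_def
  proof (intro allI impI)
    fix \<sigma> assume "L.MCauchy \<sigma>"
    then have carr: "\<sigma> n \<in> carrier (L2 M)"
      and cauchy: "0 < e \<Longrightarrow> \<exists>N. \<forall>m n. N \<le> m \<longrightarrow> N \<le> n \<longrightarrow> ip_dist (L2 M) (\<sigma> m) (\<sigma> n) < e" for n e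
      by (auto simp: L.MCauchy_def)
    define s where "s = (\<lambda>n. L2_rep (\<sigma> n))"
    have s: "square_integrable M (s n)" "\<sigma> n = L2_class M (s n)" for n
      using carr by (simp_all add: s_def L2_rep_in_carrier)
    have "\<exists>N. \<forall>m\<ge>N. \<forall>n\<ge>N. L2_norm M (\<lambda>x. s m x - s n x) < e" if "0 < e" for e
      using cauchy[OF that] s by (simp add: ip_dist_L2_class)
    from L2_complete[OF s(1) this] obtain f
      where f: "square_integrable M f" "(\<lambda>n. L2_norm M (\<lambda>x. s n x - f x)) \<longlonglongrightarrow> 0" by blast
    have "limitin L.mtopology \<sigma> (L2_class M f) sequentially"
      using f s by (simp add: L.limitin_metric_dist_null L2_class_in_carrier ip_dist_L2_class)
    then show "\<exists>u. limitin L.mtopology \<sigma> u sequentially" by blast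
  qed
qed

lemma (in prob_space) complex_hilbert_space_L2: "complex_hilbert_space (L2 M)"
proof (intro complex_hilbert_space.intro module_L2 complex_hilbert_space_axioms.intro mcomplete_L2)
  fix u v :: "('a \<Rightarrow> complex) set" and c
  assume u: "u \<in> carrier (L2 M)"
  obtain f where f: "square_integrable M f" "u = L2_class M f" by (rule L2_carrierE[OF u])
  show "0 < Re (ip (L2 M) u u)" if "u \<noteq> \<zero>\<^bsub>L2 M\<^esub>"
  proof -
    have "Re (ip (L2 M) u u) = (L2_norm M f)\<^sup>2"
      using f by (simp add: L2_ip_self flip: of_real_power)
    moreover have "L2_norm M f \<noteq> 0"
      using that f by (simp add: L2_zero L2_class_eq_iff square_integrable_zero L2_norm_eq_0_iff)
    ultimately show ?thesis by simp
  qed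
  assume v: "v \<in> carrier (L2 M)"
  obtain h where h: "square_integrable M h" "v = L2_class M h" by (rule L2_carrierE[OF v])
  show "ip (L2 M) v u = cnj (ip (L2 M) u v)"
    using f h Bochner_Integration.integral_cnj[of M "\<lambda>x. f x * cnj (h x)"] by (simp add: L2_ip_class mult.commute)
  show "ip (L2 M) (c \<odot>\<^bsub>L2 M\<^esub> u) v = c * ip (L2 M) u v"
    using f h by (simp add: L2_ip_class L2_smult_class square_integrable_cmult mult.assoc)
  fix w assume w: "w \<in> carrier (L2 M)"
  obtain k where k: "square_integrable M k" "w = L2_class M k" by (rule L2_carrierE[OF w])
  show "ip (L2 M) (u \<oplus>\<^bsub>L2 M\<^esub> v) w = ip (L2 M) u w + ip (L2 M) v w"
    using f h k by (simp add: L2_ip_class L2_add_class square_integrable_add integrable_inner distrib_right)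
qed

section \<open>Conditional expectation on square-integrable functions\<close>

lemma borel_measurable_complex_cond_exp:
  "complex_cond_exp M F f \<in> borel_measurable F"
  unfolding borel_measurable_complex_iff by (simp add: complex_cond_exp_def)

lemma square_integrable_Re_Im:
  assumes "square_integrable M f"
  shows "integrable M (\<lambda>x. (Re (f x))\<^sup>2)" "integrable M (\<lambda>x. (Im (f x))\<^sup>2)"
    "(\<lambda>x. Re (f x)) \<in> borel_measurable M" "(\<lambda>x. Im (f x)) \<in> borel_measurable M"
proof -
  have f: "f \<in> borel_measurable M" "integrable M (\<lambda>x. (cmod (f x))\<^sup>2)"
    using assms by (auto simp: square_integrable_def)
  then show m: "(\<lambda>x. Re (f x)) \<in> borel_measurable M" "(\<lambda>x. Im (f x)) \<in> borel_measurable M"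
    by (auto simp: borel_measurable_complex_iff)
  show "integrable M (\<lambda>x. (Re (f x))\<^sup>2)" "integrable M (\<lambda>x. (Im (f x))\<^sup>2)"
    using m by (auto intro!: Bochner_Integration.integrable_bound[OF f(2)] simp: cmod_power2)
qed

lemma integrable_mult_square_integrable:
  fixes p q :: "'x \<Rightarrow> real"
  assumes [measurable]: "p \<in> borel_measurable M" "q \<in> borel_measurable M"
    and pq: "integrable M (\<lambda>x. (p x)\<^sup>2)" "integrable M (\<lambda>x. (q x)\<^sup>2)"
  shows "integrable M (\<lambda>x. p x * q x)"
proof (rule Bochner_Integration.integrable_bound)
  show "integrable M (\<lambda>x. (p x)\<^sup>2 + (q x)\<^sup>2)" using pq by simp
  have "\<bar>a * b\<bar> \<le> a\<^sup>2 + b\<^sup>2" for a b :: real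
    using sum_squares_bound[of a b] sum_squares_bound[of a "-b"] zero_le_power2[of a] zero_le_power2[of b]
    by (auto simp: abs_if)
  then show "AE x in M. norm (p x * q x) \<le> norm ((p x)\<^sup>2 + (q x)\<^sup>2)" by simp
qed measurable

context prob_space
begin

context
  fixes F :: "'a measure"
  assumes F: "Conditional_Expectation.subalgebra M F"
begin

interpretation F: finite_measure_subalgebra M F
  by unfold_locales (rule F)

text \<open>Jensen's inequality for \<open>x \<mapsto> x\<^sup>2\<close> bounds the square of the conditional expectation by the
  conditional expectation of the square.\<close>

lemma integrable_power2_real_cond_exp:
  assumes p: "p \<in> borel_measurable M" "integrable M (\<lambda>x. (p x)\<^sup>2)"
  shows "integrable M (\<lambda>x. (real_cond_exp M F p x)\<^sup>2)"
proof (rule F.integrable_convex_cond_exp[where I = UNIV])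
  show "integrable M p"
    using p integrable_mult_square_integrable[OF p(1), of "\<lambda>_. 1"] by simp
  show "convex_on UNIV (\<lambda>x::real. x\<^sup>2)" by (rule convex_power2)
qed (use p in auto)

lemma real_cond_exp_orthogonal:
  assumes p: "p \<in> borel_measurable M" "integrable M (\<lambda>x. (p x)\<^sup>2)"
    and q: "q \<in> borel_measurable F" "integrable M (\<lambda>x. (q x)\<^sup>2)"
  shows "integrable M (\<lambda>x. (p x - real_cond_exp M F p x) * q x)"
    and "(\<integral>x. (p x - real_cond_exp M F p x) * q x \<partial>M) = 0"
proof -
  have qM: "q \<in> borel_measurable M" using q(1) by (rule measurable_from_subalg[OF F])
  have i: "integrable M (\<lambda>x. q x * p x)"
    using p q qM by (intro integrable_mult_square_integrable)
  have *: "(\<lambda>x. (p x - real_cond_exp M F p x) * q x) = (\<lambda>x. q x * p x - q x * real_cond_exp M F p x)"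
    by (simp add: algebra_simps)
  show "integrable M (\<lambda>x. (p x - real_cond_exp M F p x) * q x)"
    "(\<integral>x. (p x - real_cond_exp M F p x) * q x \<partial>M) = 0"
    unfolding * using F.real_cond_exp_intg[OF i q(1) p(1)] i by auto
qed

lemma square_integrable_complex_cond_exp:
  assumes f: "square_integrable M f"
  shows "square_integrable M (complex_cond_exp M F f)"
proof -
  have "integrable M (\<lambda>x. (real_cond_exp M F (\<lambda>y. Re (f y)) x)\<^sup>2 + (real_cond_exp M F (\<lambda>y. Im (f y)) x)\<^sup>2)"
    using square_integrable_Re_Im[OF f]
    by (intro Bochner_Integration.integrable_add integrable_power2_real_cond_exp)
  then show ?thesis
    using measurable_from_subalg[OF F borel_measurable_complex_cond_exp]
    by (simp add: square_integrable_def complex_cond_exp_def cmod_power2)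
qed

text \<open>This is what makes conditional expectation an orthogonal projection: the remainder
  \<open>f - E[f | F]\<close> is orthogonal to every \<open>F\<close>-measurable function. The four products of real and
  imaginary parts reduce it to the real case.\<close>

lemma complex_cond_exp_orthogonal:
  assumes f: "square_integrable M f" and k: "square_integrable M k" "k \<in> borel_measurable F"
  shows "(\<integral>x. (f x - complex_cond_exp M F f x) * cnj (k x) \<partial>M) = 0"
proof -
  have kF: "(\<lambda>x. Re (k x)) \<in> borel_measurable F" "(\<lambda>x. Im (k x)) \<in> borel_measurable F"
    using k(2) by (auto simp: borel_measurable_complex_iff)
  note f' = square_integrable_Re_Im[OF f] and k' = square_integrable_Re_Im[OF k(1)]
  note rr = real_cond_exp_orthogonal[OF f'(3) f'(1) kF(1) k'(1)]
  note ri = real_cond_exp_orthogonal[OF f'(3) f'(1) kF(2) k'(2)]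
  note ir = real_cond_exp_orthogonal[OF f'(4) f'(2) kF(1) k'(1)]
  note ii = real_cond_exp_orthogonal[OF f'(4) f'(2) kF(2) k'(2)]
  let ?h = "\<lambda>x. (f x - complex_cond_exp M F f x) * cnj (k x)"
  have i: "integrable M ?h"
    by (intro integrable_inner square_integrable_diff f k square_integrable_complex_cond_exp)
  have "Re (integral\<^sup>L M ?h) = (\<integral>x. Re (?h x) \<partial>M)"
    using integral_Re[OF i] by simp
  also have "\<dots> = 0"
    using rr ri ir ii by (simp add: complex_cond_exp_def)
  finally have 1: "Re (integral\<^sup>L M ?h) = 0" .
  have "Im (integral\<^sup>L M ?h) = (\<integral>x. Im (?h x) \<partial>M)"
    using integral_Im[OF i] by simp
  also have "\<dots> = 0"
    using rr ri ir ii by (simp add: complex_cond_exp_def)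
  finally have 2: "Im (integral\<^sup>L M ?h) = 0" .
  from 1 2 show ?thesis by (simp add: complex_eq_iff)
qed

lemma complex_cond_exp_measurable_eq:
  assumes f: "square_integrable M f" "f \<in> borel_measurable F"
  shows "AE x in M. complex_cond_exp M F f x = f x"
proof -
  have i: "integrable M f" by (rule square_integrable_imp_integrable[OF f(1)])
  have "AE x in M. real_cond_exp M F (\<lambda>y. Re (f y)) x = Re (f x)"
    "AE x in M. real_cond_exp M F (\<lambda>y. Im (f y)) x = Im (f x)"
    using i f(2) by (auto simp: borel_measurable_complex_iff)
  then show ?thesis by eventually_elim (simp add: complex_cond_exp_def)
qed

end

lemma complex_cond_exp_nested:
  assumes sub: "Conditional_Expectation.subalgebra M G" "Conditional_Expectation.subalgebra G F" and f: "square_integrable M f"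
  shows "AE x in M. complex_cond_exp M F (complex_cond_exp M G f) x = complex_cond_exp M F f x"
proof -
  have "Conditional_Expectation.subalgebra M F" using sub by (auto simp: Conditional_Expectation.subalgebra_def)
  then interpret F: finite_measure_subalgebra M F by unfold_locales
  have i: "integrable M f" by (rule square_integrable_imp_integrable[OF f])
  have "AE x in M. real_cond_exp M F (real_cond_exp M G (\<lambda>y. Re (f y))) x = real_cond_exp M F (\<lambda>y. Re (f y)) x"
    "AE x in M. real_cond_exp M F (real_cond_exp M G (\<lambda>y. Im (f y))) x = real_cond_exp M F (\<lambda>y. Im (f y)) x"
    using sub i by auto
  then show ?thesis
    by eventually_elim (simp add: complex_cond_exp_def)
qed

end

section \<open>Measure-preserving maps and representatives of the action\<close>

lemma AE_compose_measure_preserving: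
  assumes "T \<in> measurable M M" "distr M M T = M" "AE x in M. P x"
  shows "AE x in M. P (T x)"
proof (rule AE_distrD[OF assms(1)])
  show "AE x in distr M M T. P x" unfolding assms(2) by (rule assms(3))
qed

lemma square_integrable_compose:
  assumes T: "T \<in> measurable M M" "distr M M T = M" and f: "square_integrable M f"
  shows "square_integrable M (\<lambda>x. f (T x))"
proof -
  have "integrable (distr M M T) (\<lambda>x. (cmod (f x))\<^sup>2)"
    using f T(2) by (simp add: square_integrable_def)
  from integrable_distr[OF T(1) this] show ?thesis
    using f T(1) by (auto simp: square_integrable_def)
qed

lemma integral_compose:
  fixes f :: "'x \<Rightarrow> 'b :: {banach, second_countable_topology}"
  assumes T: "T \<in> measurable M M" "distr M M T = M" and f: "f \<in> borel_measurable M"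
  shows "(\<integral>x. f (T x) \<partial>M) = (\<integral>x. f x \<partial>M)"
  using integral_distr[OF T(1) f] T(2) by simp

lemma L2_norm_compose:
  assumes T: "T \<in> measurable M M" "distr M M T = M" and f: "f \<in> borel_measurable M"
  shows "L2_norm M (\<lambda>x. f (T x)) = L2_norm M f"
  using integral_compose[OF T, of "\<lambda>x. (cmod (f x))\<^sup>2"] f by (simp add: L2_norm_def)

lemma mp_bijectionsD:
  assumes "T \<in> mp_bijections M"
  shows "T \<in> measurable M M" "distr M M T = M" "bij_betw T (space M) (space M)"
  using assms by (auto simp: mp_bijections_def Bij_def)

lemma mp_bijections_image:
  assumes T: "T \<in> mp_bijections M" and Y: "Y \<in> sets M"
  shows "T ` Y \<in> sets M"
proof -
  have "inv_into (space M) T -` Y \<inter> space M \<in> sets M"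
    using T Y by (auto simp: mp_bijections_def)
  also have "inv_into (space M) T -` Y \<inter> space M = T ` Y"
  proof (intro Set.set_eqI iffI)
    fix x assume "x \<in> inv_into (space M) T -` Y \<inter> space M"
    then show "x \<in> T ` Y"
      using bij_betw_inv_into_right[OF mp_bijectionsD(3)[OF T], of x] by force
  next
    fix x assume "x \<in> T ` Y"
    then obtain y where y: "y \<in> Y" "y \<in> space M" "x = T y"
      using sets.sets_into_space[OF Y] by blast
    then show "x \<in> inv_into (space M) T -` Y \<inter> space M"
      using bij_betw_inv_into_left[OF mp_bijectionsD(3)[OF T], of y]
        bij_betwE[OF mp_bijectionsD(3)[OF T]] by auto
  qed
  finally show ?thesis .
qed

lemma equiv_mp_eq: "equiv (mp_bijections M) (mp_eq M)"
proof (rule equivI)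
  show "mp_eq M \<subseteq> mp_bijections M \<times> mp_bijections M"
    by (auto simp: mp_eq_def)
  show "refl_on (mp_bijections M) (mp_eq M)"
    by (auto simp: refl_on_def mp_eq_def)
  show "sym (mp_eq M)"
    by (auto simp: sym_def mp_eq_def elim: eventually_mono)
  show "trans (mp_eq M)"
  proof (rule transI)
    fix R S T assume RS: "(R, S) \<in> mp_eq M" "(S, T) \<in> mp_eq M"
    then have "AE x in M. R x = S x" "AE x in M. S x = T x" by (auto simp: mp_eq_def)
    then have "AE x in M. R x = T x" by eventually_elim simp
    with RS show "(R, T) \<in> mp_eq M" by (auto simp: mp_eq_def)
  qed
qed

lemma aut_rep:
  assumes a: "a \<in> carrier (Aut M)"
  shows "aut_rep a \<in> a" and "aut_rep a \<in> mp_bijections M"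
    and "S \<in> a \<Longrightarrow> AE x in M. S x = aut_rep a x"
proof -
  have a': "a \<in> mp_bijections M // mp_eq M" using a by (simp add: Aut_def)
  then obtain T where "T \<in> a" using in_quotient_imp_non_empty[OF equiv_mp_eq] by blast
  then show 1: "aut_rep a \<in> a" unfolding aut_rep_def by (rule someI[of "\<lambda>T. T \<in> a"])
  then show "aut_rep a \<in> mp_bijections M"
    using in_quotient_imp_subset[OF equiv_mp_eq a'] by blast
  assume "S \<in> a"
  then have "(S, aut_rep a) \<in> mp_eq M"
    using quotient_eq_iff[OF equiv_mp_eq a' a'] 1 by blast
  then show "AE x in M. S x = aut_rep a x" by (simp add: mp_eq_def)
qed

text \<open>The product of \<^const>\<open>Aut\<close> is generated by composites of arbitrary members of the two classes.
  Replacing these members by the chosen representatives changes the composite only on a null set,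
  because the preimage of a null set under the inner map is null.\<close>

lemma aut_rep_mult:
  assumes a: "a \<in> carrier (Aut M)" and b: "b \<in> carrier (Aut M)"
    and ab: "a \<otimes>\<^bsub>Aut M\<^esub> b \<in> carrier (Aut M)"
  shows "AE x in M. aut_rep (a \<otimes>\<^bsub>Aut M\<^esub> b) x = aut_rep a (aut_rep b x)"
proof -
  have "aut_rep (a \<otimes>\<^bsub>Aut M\<^esub> b) \<in> mp_eq M `` {compose (space M) S T | S T. S \<in> a \<and> T \<in> b}"
    using aut_rep(1)[OF ab] by (simp add: Aut_def)
  then obtain S T where ST: "S \<in> a" "T \<in> b"
    "(compose (space M) S T, aut_rep (a \<otimes>\<^bsub>Aut M\<^esub> b)) \<in> mp_eq M" by blast
  have "AE x in M. compose (space M) S T x = aut_rep (a \<otimes>\<^bsub>Aut M\<^esub> b) x"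
    using ST(3) by (simp add: mp_eq_def)
  moreover have "AE x in M. T x = aut_rep b x" by (rule aut_rep(3)[OF b ST(2)])
  moreover have "AE x in M. S (aut_rep b x) = aut_rep a (aut_rep b x)"
    by (rule AE_compose_measure_preserving[OF mp_bijectionsD(1,2)[OF aut_rep(2)[OF b]] aut_rep(3)[OF a ST(1)]])
  ultimately show ?thesis
    using AE_space by eventually_elim (simp add: compose_def)
qed

lemma (in closed_permutation_group) perm_group_simps:
  "\<one>\<^bsub>BijGroup \<Omega>\<^esub> \<in> G"
  "g \<in> G \<Longrightarrow> g \<in> carrier (BijGroup \<Omega>)"
  "g \<in> G \<Longrightarrow> inv\<^bsub>BijGroup \<Omega>\<^esub> g \<in> G"
  "g \<in> G \<Longrightarrow> h \<in> G \<Longrightarrow> g \<otimes>\<^bsub>BijGroup \<Omega>\<^esub> h \<in> G"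
  using subgroup subgroup.subset[OF subgroup]
  by (auto simp: subgroup.one_closed subgroup.m_inv_closed subgroup.m_closed)

context boolean_pmp_action
begin

abbreviation act :: "('w \<Rightarrow> 'w) \<Rightarrow> 'x \<Rightarrow> 'x" where
  "act g \<equiv> aut_rep (\<alpha> g)"

abbreviation inverse_perm :: "('w \<Rightarrow> 'w) \<Rightarrow> 'w \<Rightarrow> 'w" where
  "inverse_perm g \<equiv> inv\<^bsub>BijGroup \<Omega>\<^esub> g"

lemma \<alpha>_carrier: "g \<in> G \<Longrightarrow> \<alpha> g \<in> carrier (Aut M)"
  using hom_in_carrier[OF hom] by simp

lemma act_mp: "g \<in> G \<Longrightarrow> act g \<in> mp_bijections M"
  by (rule aut_rep(2)[OF \<alpha>_carrier])

lemmas act_measurable = mp_bijectionsD(1)[OF act_mp]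
lemmas act_distr = mp_bijectionsD(2)[OF act_mp]
lemmas act_bij = mp_bijectionsD(3)[OF act_mp]

lemma act_space: "g \<in> G \<Longrightarrow> x \<in> space M \<Longrightarrow> act g x \<in> space M"
  by (rule measurable_space[OF act_measurable])

lemma act_inj: "g \<in> G \<Longrightarrow> x \<in> space M \<Longrightarrow> y \<in> space M \<Longrightarrow> act g x = act g y \<longleftrightarrow> x = y"
  using act_bij by (auto simp: bij_betw_def inj_on_def)

lemma AE_act: "g \<in> G \<Longrightarrow> AE x in M. P x \<Longrightarrow> AE x in M. P (act g x)"
  by (rule AE_compose_measure_preserving[OF act_measurable act_distr])

lemma square_integrable_act:
  "g \<in> G \<Longrightarrow> square_integrable M f \<Longrightarrow> square_integrable M (\<lambda>x. f (act g x))"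
  by (rule square_integrable_compose[OF act_measurable act_distr])

lemma act_mult:
  assumes "g \<in> G" "h \<in> G"
  shows "AE x in M. act (g \<otimes>\<^bsub>BijGroup \<Omega>\<^esub> h) x = act g (act h x)"
proof -
  have eq: "\<alpha> (g \<otimes>\<^bsub>BijGroup \<Omega>\<^esub> h) = \<alpha> g \<otimes>\<^bsub>Aut M\<^esub> \<alpha> h"
    using hom_mult[OF hom, of g h] assms by simp
  moreover have "\<alpha> g \<otimes>\<^bsub>Aut M\<^esub> \<alpha> h \<in> carrier (Aut M)"
    using \<alpha>_carrier[of "g \<otimes>\<^bsub>BijGroup \<Omega>\<^esub> h"] assms by (simp add: perm_group_simps flip: eq)
  ultimately show ?thesis
    using aut_rep_mult[OF \<alpha>_carrier \<alpha>_carrier] assms by simp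
qed

text \<open>A homomorphism sends the identity to an idempotent class, and an injective map that agrees
  almost everywhere with its square is almost everywhere the identity.\<close>

lemma act_one: "AE x in M. act \<one>\<^bsub>BijGroup \<Omega>\<^esub> x = x"
proof -
  interpret B: group "BijGroup \<Omega>" by (rule group_BijGroup)
  have "AE x in M. act \<one>\<^bsub>BijGroup \<Omega>\<^esub> x = act \<one>\<^bsub>BijGroup \<Omega>\<^esub> (act \<one>\<^bsub>BijGroup \<Omega>\<^esub> x)"
    using act_mult[OF perm_group_simps(1,1)] unfolding B.l_one[OF B.one_closed] .
  then show ?thesis
    using AE_space
  proof eventually_elim
    case (elim x)
    then show ?case
      using act_inj[OF perm_group_simps(1), of "act \<one>\<^bsub>BijGroup \<Omega>\<^esub> x" x]
        act_space[OF perm_group_simps(1)] by metis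
  qed
qed

lemma act_inverse:
  assumes g: "g \<in> G"
  shows "AE x in M. act g (act (inverse_perm g) x) = x"
    and "AE x in M. act (inverse_perm g) (act g x) = x"
proof -
  interpret B: group "BijGroup \<Omega>" by (rule group_BijGroup)
  note ig = perm_group_simps(3)[OF g] and gB = perm_group_simps(2)[OF g]
  show "AE x in M. act g (act (inverse_perm g) x) = x"
    using act_mult[OF g ig, unfolded B.r_inv[OF gB]] act_one by eventually_elim (rule trans[OF sym])
  show "AE x in M. act (inverse_perm g) (act g x) = x"
    using act_mult[OF ig g, unfolded B.l_inv[OF gB]] act_one by eventually_elim (rule trans[OF sym])
qed

text \<open>Images under \<open>act g\<close> are, up to null sets, preimages under \<open>act (g\<^sup>-\<^sup>1)\<close>. This links the weak
  topology and the \<open>\<sigma>\<close>-algebras of invariant sets, which are defined by images, to the Koopman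
  representation, which composes with the inverse.\<close>

lemma aut_image_iff:
  assumes g: "g \<in> G" and Y: "Y \<in> sets M"
  shows "AE x in M. x \<in> aut_image (\<alpha> g) Y \<longleftrightarrow> act (inverse_perm g) x \<in> Y"
  using act_inverse(1)[OF g] AE_space
proof eventually_elim
  case (elim x)
  have "act (inverse_perm g) x \<in> space M"
    by (rule act_space[OF perm_group_simps(3)[OF g] elim(2)])
  with inj_on_image_mem_iff[OF bij_betw_imp_inj_on[OF act_bij[OF g]] _ sets.sets_into_space[OF Y]]
  have "act g (act (inverse_perm g) x) \<in> act g ` Y \<longleftrightarrow> act (inverse_perm g) x \<in> Y"
    by this
  then show ?case
    unfolding aut_image_def elim(1) .
qed

lemma aut_image_sets: "g \<in> G \<Longrightarrow> Y \<in> sets M \<Longrightarrow> aut_image (\<alpha> g) Y \<in> sets M"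
  unfolding aut_image_def by (intro mp_bijections_image act_mp)

section \<open>The Koopman representation is unitary\<close>

lemma koopman_class:
  assumes g: "g \<in> G" and f: "square_integrable M f"
  shows "koopman \<Omega> M \<alpha> g (L2_class M f) = L2_class M (\<lambda>x. f (act (inverse_perm g) x))"
proof -
  have ig: "inverse_perm g \<in> G" by (rule perm_group_simps(3)[OF g])
  have "AE x in M. L2_rep (L2_class M f) (act (inverse_perm g) x) = f (act (inverse_perm g) x)"
    by (rule AE_act[OF ig L2_rep_class(2)[OF f]])
  then have "L2_class M (\<lambda>x. L2_rep (L2_class M f) (act (inverse_perm g) x))
      = L2_class M (\<lambda>x. f (act (inverse_perm g) x))"
    by (intro L2_class_eq_iff[THEN iffD2] square_integrable_act[OF ig] L2_rep_class(1)[OF f] f)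
  then show ?thesis
    using f by (simp add: koopman_def L2_class_in_carrier)
qed

lemma koopman_carrier:
  "g \<in> G \<Longrightarrow> u \<in> carrier (L2 M) \<Longrightarrow> koopman \<Omega> M \<alpha> g u \<in> carrier (L2 M)"
  by (elim L2_carrierE)
    (simp only: koopman_class L2_class_in_carrier square_integrable_act perm_group_simps(3))

lemma koopman_mult:
  assumes g: "g \<in> G" and h: "h \<in> G" and u: "u \<in> carrier (L2 M)"
  shows "koopman \<Omega> M \<alpha> (g \<otimes>\<^bsub>BijGroup \<Omega>\<^esub> h) u = koopman \<Omega> M \<alpha> g (koopman \<Omega> M \<alpha> h u)"
proof -
  interpret B: group "BijGroup \<Omega>" by (rule group_BijGroup)
  obtain f where f: "square_integrable M f" "u = L2_class M f" by (rule L2_carrierE[OF u])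
  have i: "inverse_perm g \<in> G" "inverse_perm h \<in> G" using g h by (auto simp: perm_group_simps)
  have inv_eq: "inverse_perm (g \<otimes>\<^bsub>BijGroup \<Omega>\<^esub> h) = inverse_perm h \<otimes>\<^bsub>BijGroup \<Omega>\<^esub> inverse_perm g"
    using g h by (simp add: B.inv_mult_group perm_group_simps)
  have "AE x in M. f (act (inverse_perm (g \<otimes>\<^bsub>BijGroup \<Omega>\<^esub> h)) x)
      = f (act (inverse_perm h) (act (inverse_perm g) x))"
    using act_mult[OF i(2,1)] unfolding inv_eq by eventually_elim simp
  then have "L2_class M (\<lambda>x. f (act (inverse_perm (g \<otimes>\<^bsub>BijGroup \<Omega>\<^esub> h)) x))
      = L2_class M (\<lambda>x. f (act (inverse_perm h) (act (inverse_perm g) x)))"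
    using f(1) i g h
    by (intro L2_class_eq_iff[THEN iffD2] square_integrable_act[where f = f]
        square_integrable_act[where f = "\<lambda>y. f (act (inverse_perm h) y)"] perm_group_simps)
  then show ?thesis
    using f g h i by (simp add: koopman_class perm_group_simps square_integrable_act)
qed

lemma koopman_one:
  assumes u: "u \<in> carrier (L2 M)"
  shows "koopman \<Omega> M \<alpha> \<one>\<^bsub>BijGroup \<Omega>\<^esub> u = u"
proof -
  interpret B: group "BijGroup \<Omega>" by (rule group_BijGroup)
  obtain f where f: "square_integrable M f" "u = L2_class M f" by (rule L2_carrierE[OF u])
  have "AE x in M. f (act \<one>\<^bsub>BijGroup \<Omega>\<^esub> x) = f x"
    using act_one by eventually_elim simp
  then have "L2_class M (\<lambda>x. f (act \<one>\<^bsub>BijGroup \<Omega>\<^esub> x)) = L2_class M f"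
    using f(1) by (intro L2_class_eq_iff[THEN iffD2] square_integrable_act perm_group_simps)
  then show ?thesis
    using f by (simp add: koopman_class perm_group_simps)
qed

lemma koopman_unitary:
  assumes g: "g \<in> G"
  shows "koopman \<Omega> M \<alpha> g \<in> carrier (unitary_group (L2 M))"
proof -
  interpret B: group "BijGroup \<Omega>" by (rule group_BijGroup)
  let ?U = "koopman \<Omega> M \<alpha> g" and ?V = "koopman \<Omega> M \<alpha> (inverse_perm g)"
  have ig: "inverse_perm g \<in> G" by (rule perm_group_simps(3)[OF g])
  have "?V (?U u) = u" "?U (?V u) = u" if "u \<in> carrier (L2 M)" for u
    using that koopman_mult[OF g ig] koopman_mult[OF ig g] koopman_one g
    by (simp_all add: perm_group_simps)
  then have "bij_betw ?U (carrier (L2 M)) (carrier (L2 M))"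
    using koopman_carrier g ig by (intro bij_betw_byWitness[where f' = ?V]) auto
  moreover have "?U \<in> extensional (carrier (L2 M))"
    by (simp add: koopman_def)
  moreover have "?U (u \<oplus>\<^bsub>L2 M\<^esub> v) = ?U u \<oplus>\<^bsub>L2 M\<^esub> ?U v \<and> ip (L2 M) (?U u) (?U v) = ip (L2 M) u v"
    if u: "u \<in> carrier (L2 M)" and v: "v \<in> carrier (L2 M)" for u v
  proof -
    obtain f where f: "square_integrable M f" "u = L2_class M f" by (rule L2_carrierE[OF u])
    obtain h where h: "square_integrable M h" "v = L2_class M h" by (rule L2_carrierE[OF v])
    note sq = square_integrable_act[OF ig]
    have "(\<integral>x. f (act (inverse_perm g) x) * cnj (h (act (inverse_perm g) x)) \<partial>M) = (\<integral>x. f x * cnj (h x) \<partial>M)"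
      by (rule integral_compose[OF act_measurable[OF ig] act_distr[OF ig]
            borel_measurable_integrable[OF integrable_inner[OF f(1) h(1)]]])
    then show ?thesis
      using f h g sq by (simp add: koopman_class L2_add_class L2_ip_class square_integrable_add)
  qed
  moreover have "?U (c \<odot>\<^bsub>L2 M\<^esub> u) = c \<odot>\<^bsub>L2 M\<^esub> ?U u" if u: "u \<in> carrier (L2 M)" for c u
  proof -
    obtain f where f: "square_integrable M f" "u = L2_class M f" by (rule L2_carrierE[OF u])
    then show ?thesis
      using g square_integrable_act[OF ig]
      by (simp add: koopman_class L2_smult_class square_integrable_cmult)
  qed
  ultimately show ?thesis
    by (simp add: unitary_group_def Bij_def)
qed

lemma koopman_hom: "koopman \<Omega> M \<alpha> \<in> hom (perm_group \<Omega> G) (unitary_group (L2 M))"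
proof (rule homI)
  fix g assume "g \<in> carrier (perm_group \<Omega> G)"
  then show "koopman \<Omega> M \<alpha> g \<in> carrier (unitary_group (L2 M))" by (simp add: koopman_unitary)
next
  fix g h assume "g \<in> carrier (perm_group \<Omega> G)" "h \<in> carrier (perm_group \<Omega> G)"
  then have gh: "g \<in> G" "h \<in> G" by simp_all
  have B: "koopman \<Omega> M \<alpha> k \<in> Bij (carrier (L2 M))" if "k \<in> G" for k
    using koopman_unitary[OF that] by (simp add: unitary_group_def)
  have "koopman \<Omega> M \<alpha> (g \<otimes>\<^bsub>BijGroup \<Omega>\<^esub> h)
      = compose (carrier (L2 M)) (koopman \<Omega> M \<alpha> g) (koopman \<Omega> M \<alpha> h)"
    using koopman_mult[OF gh]
    by (intro extensionalityI[of _ "carrier (L2 M)"])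
      (auto simp: koopman_def compose_def)
  then show "koopman \<Omega> M \<alpha> (g \<otimes>\<^bsub>perm_group \<Omega> G\<^esub> h)
      = koopman \<Omega> M \<alpha> g \<otimes>\<^bsub>unitary_group (L2 M)\<^esub> koopman \<Omega> M \<alpha> h"
    using B gh by (simp add: unitary_group_def BijGroup_def)
qed

end

section \<open>Strong continuity of the Koopman representation\<close>

lemma L2_simple_function_approximation:
  assumes f: "square_integrable M f" and e: "0 < e"
  shows "\<exists>s. simple_function M s \<and> square_integrable M s \<and> L2_norm M (\<lambda>x. f x - s x) < e"
proof -
  have [measurable]: "f \<in> borel_measurable M" using f by (simp add: square_integrable_def)
  obtain s where s: "\<And>i. simple_function M (s i)"
    "\<And>x. x \<in> space M \<Longrightarrow> (\<lambda>i. s i x) \<longlonglongrightarrow> f x"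
    "\<And>i x. x \<in> space M \<Longrightarrow> cmod (s i x) \<le> 2 * cmod (f x)"
    using borel_measurable_implies_sequence_metric[of f M 0] by simp metis
  have [measurable]: "s i \<in> borel_measurable M" for i
    by (rule borel_measurable_simple_function[OF s(1)])
  \<comment> \<open>The approximants satisfy \<open>\<bar>s i x\<bar> \<le> 2 \<bar>f x\<bar>\<close>, hence the factor \<open>(1 + 2)\<^sup>2\<close>.\<close>
  have bound: "(cmod (f x - s i x))\<^sup>2 \<le> 9 * (cmod (f x))\<^sup>2" if "x \<in> space M" for i x
  proof -
    have "cmod (f x - s i x) \<le> 3 * cmod (f x)"
      using norm_triangle_ineq4[of "f x" "s i x"] s(3)[OF that, of i] by linarith
    from power_mono[OF this, of 2] show ?thesis by (simp add: power_mult_distrib)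
  qed
  have "(\<lambda>i. \<integral>x. (cmod (f x - s i x))\<^sup>2 \<partial>M) \<longlonglongrightarrow> (\<integral>x. 0 \<partial>M)"
  proof (rule integral_dominated_convergence[where w = "\<lambda>x. 9 * (cmod (f x))\<^sup>2"])
    show "integrable M (\<lambda>x. 9 * (cmod (f x))\<^sup>2)"
      using f by (simp add: square_integrable_def)
    show "AE x in M. (\<lambda>i. (cmod (f x - s i x))\<^sup>2) \<longlonglongrightarrow> 0"
    proof (rule AE_I2)
      fix x assume "x \<in> space M"
      from tendsto_power[OF tendsto_norm[OF tendsto_diff[OF tendsto_const[of "f x"] s(2)[OF this]]], of 2]
      show "(\<lambda>i. (cmod (f x - s i x))\<^sup>2) \<longlonglongrightarrow> 0" by simp
    qed
    show "AE x in M. norm ((cmod (f x - s i x))\<^sup>2) \<le> 9 * (cmod (f x))\<^sup>2" for i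
      using bound by (intro AE_I2) simp
  qed measurable
  then have "(\<lambda>i. L2_norm M (\<lambda>x. f x - s i x)) \<longlonglongrightarrow> 0"
    using tendsto_real_sqrt unfolding L2_norm_def by fastforce
  then have "\<forall>\<^sub>F i in sequentially. L2_norm M (\<lambda>x. f x - s i x) < e"
    using e by (rule order_tendstoD)
  then obtain i where i: "L2_norm M (\<lambda>x. f x - s i x) < e"
    by (auto simp: eventually_sequentially)
  have "square_integrable M (s i)"
    using s(3) by (intro square_integrable_bound[OF square_integrable_cmult[OF f, of 2]])
      (auto simp: norm_mult)
  with i s(1) show ?thesis by blast
qed

lemma (in finite_measure) square_integrable_indicator:
  "Y \<in> sets M \<Longrightarrow> square_integrable M (indicator Y)"
  by (auto simp: square_integrable_def indicator_def if_distrib cong: if_cong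
      intro!: integrable_const_bound[where B = 1])

context boolean_pmp_action
begin

text \<open>Continuity of the orbit map \<open>g \<mapsto> g \<cdot> f\<close>, expressed for the function \<open>f\<close> rather than for its class.
  The functions with this property are shown to contain the indicators and to be closed under
  linear combinations and \<open>L\<^sup>2\<close>-limits.\<close>

definition orbit_continuous :: "('x \<Rightarrow> complex) \<Rightarrow> bool" where
  "orbit_continuous f \<longleftrightarrow> (\<forall>g0\<in>G. \<forall>e>0. \<exists>U. openin (perm_topology \<Omega> G) U \<and> g0 \<in> U \<and>
     (\<forall>g\<in>U. L2_norm M (\<lambda>x. f (act (inverse_perm g) x) - f (act (inverse_perm g0) x)) < e))"

lemma orbit_continuousD:
  assumes "orbit_continuous f" "g0 \<in> G" "0 < e"
  shows "\<exists>U. openin (perm_topology \<Omega> G) U \<and> g0 \<in> U \<and>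
     (\<forall>g\<in>U. L2_norm M (\<lambda>x. f (act (inverse_perm g) x) - f (act (inverse_perm g0) x)) < e)"
  using assms unfolding orbit_continuous_def by simp

lemma openin_perm_subset: "openin (perm_topology \<Omega> G) U \<Longrightarrow> U \<subseteq> G"
  using openin_subset by fastforce

lemma G_subset_topspace: "G \<subseteq> topspace (perm_topology \<Omega> G)"
  using perm_group_simps(2)
  by (auto simp: Sym_topology_def BijGroup_def Bij_def PiE_def bij_betw_def)

text \<open>The squared \<open>L\<^sup>2\<close>-distance of two translates of the indicator of \<open>Y\<close> is
  \<open>\<mu>(g Y \<triangle> g0 Y)\<close>, one of the pseudometrics that define the weak topology.\<close>

lemma orbit_continuous_indicator:
  assumes Y: "Y \<in> sets M"
  shows "orbit_continuous (indicator Y)"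
  unfolding orbit_continuous_def
proof (intro ballI allI impI)
  fix g0 and e :: real assume g0: "g0 \<in> G" and e: "0 < e"
  define W where "W = {a \<in> carrier (Aut M). measure M (sym_diff (aut_image a Y) (aut_image (\<alpha> g0) Y)) < e\<^sup>2}"
  define U where "U = {g \<in> topspace (perm_topology \<Omega> G). \<alpha> g \<in> W}"
  have "openin (weak_topology M) W"
    unfolding weak_topology_def W_def using \<alpha>_carrier[OF g0] Y e
    by (intro topology_generated_by_Basis) (auto intro!: exI[of _ "\<alpha> g0"] exI[of _ Y] exI[of _ "e\<^sup>2"])
  then have U: "openin (perm_topology \<Omega> G) U"
    unfolding U_def by (rule openin_continuous_map_preimage[OF continuous])
  have "g0 \<in> U"
    using g0 G_subset_topspace e \<alpha>_carrier[OF g0] by (auto simp: U_def W_def)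
  moreover have "L2_norm M (\<lambda>x. indicator Y (act (inverse_perm g) x) - indicator Y (act (inverse_perm g0) x)) < e"
    if "g \<in> U" for g
  proof -
    have g: "g \<in> G" using openin_perm_subset[OF U] that by blast
    let ?A = "aut_image (\<alpha> g) Y" and ?B = "aut_image (\<alpha> g0) Y"
    have AB: "?A \<in> sets M" "?B \<in> sets M" using g g0 Y by (auto intro: aut_image_sets)
    have ig: "inverse_perm g \<in> G" "inverse_perm g0 \<in> G" using g g0 by (auto intro: perm_group_simps)
    have [measurable]: "act (inverse_perm g) \<in> measurable M M" "act (inverse_perm g0) \<in> measurable M M"
      using ig by (auto intro: act_measurable)
    have "AE x in M. (cmod (indicator Y (act (inverse_perm g) x) - indicator Y (act (inverse_perm g0) x)))\<^sup>2
        = indicator (sym_diff ?A ?B) x"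
      using aut_image_iff[OF g Y] aut_image_iff[OF g0 Y]
      by eventually_elim (auto simp: indicator_def)
    then have "(\<integral>x. (cmod (indicator Y (act (inverse_perm g) x) - indicator Y (act (inverse_perm g0) x)))\<^sup>2 \<partial>M)
        = (\<integral>x. indicator (sym_diff ?A ?B) x \<partial>M)"
      using AB Y by (intro integral_cong_AE) auto
    also have "\<dots> = measure M (sym_diff ?A ?B)"
      using AB by simp
    also have "\<dots> < e\<^sup>2" using that by (simp add: U_def W_def)
    finally show ?thesis
      unfolding L2_norm_def using e real_sqrt_less_iff[of _ "e\<^sup>2"] by simp
  qed
  ultimately show "\<exists>U. openin (perm_topology \<Omega> G) U \<and> g0 \<in> U \<and>
      (\<forall>g\<in>U. L2_norm M (\<lambda>x. indicator Y (act (inverse_perm g) x) - indicator Y (act (inverse_perm g0) x)) < e)"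
    using U by blast
qed

lemma orbit_continuous_cmult:
  assumes "orbit_continuous f"
  shows "orbit_continuous (\<lambda>x. c * f x)"
  unfolding orbit_continuous_def
proof (intro ballI allI impI)
  fix g0 and e :: real assume g0: "g0 \<in> G" and e: "0 < e"
  \<comment> \<open>\<open>cmod c + 1\<close> instead of \<open>cmod c\<close>, which may vanish\<close>
  have "0 < e / (cmod c + 1)" using e by (simp add: add_nonneg_pos)
  obtain U where U: "openin (perm_topology \<Omega> G) U" "g0 \<in> U"
    and lt: "\<And>g. g \<in> U \<Longrightarrow> L2_norm M (\<lambda>x. f (act (inverse_perm g) x) - f (act (inverse_perm g0) x)) < e / (cmod c + 1)"
    using orbit_continuousD[OF assms g0 \<open>0 < e / (cmod c + 1)\<close>] by blast
  have "L2_norm M (\<lambda>x. c * f (act (inverse_perm g) x) - c * f (act (inverse_perm g0) x)) < e"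
    if "g \<in> U" for g
  proof -
    let ?n = "L2_norm M (\<lambda>x. f (act (inverse_perm g) x) - f (act (inverse_perm g0) x))"
    have "L2_norm M (\<lambda>x. c * f (act (inverse_perm g) x) - c * f (act (inverse_perm g0) x)) = cmod c * ?n"
      unfolding right_diff_distrib[symmetric] by (rule L2_norm_cmult)
    also have "\<dots> \<le> (cmod c + 1) * ?n"
      by (intro mult_right_mono L2_norm_nonneg) simp
    also have "\<dots> < e"
      using lt[OF that] by (simp add: pos_less_divide_eq add_nonneg_pos mult.commute)
    finally show ?thesis .
  qed
  with U show "\<exists>U. openin (perm_topology \<Omega> G) U \<and> g0 \<in> U \<and>
      (\<forall>g\<in>U. L2_norm M (\<lambda>x. c * f (act (inverse_perm g) x) - c * f (act (inverse_perm g0) x)) < e)"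
    by blast
qed

lemma orbit_continuous_add:
  assumes f: "orbit_continuous f" "square_integrable M f"
    and h: "orbit_continuous h" "square_integrable M h"
  shows "orbit_continuous (\<lambda>x. f x + h x)"
  unfolding orbit_continuous_def
proof (intro ballI allI impI)
  fix g0 and e :: real assume g0: "g0 \<in> G" and e: "0 < e"
  then have e2: "0 < e / 2" by simp
  obtain U where U: "openin (perm_topology \<Omega> G) U" "g0 \<in> U"
    and ltU: "\<And>g. g \<in> U \<Longrightarrow> L2_norm M (\<lambda>x. f (act (inverse_perm g) x) - f (act (inverse_perm g0) x)) < e / 2"
    using orbit_continuousD[OF f(1) g0 e2] by blast
  obtain V where V: "openin (perm_topology \<Omega> G) V" "g0 \<in> V"
    and ltV: "\<And>g. g \<in> V \<Longrightarrow> L2_norm M (\<lambda>x. h (act (inverse_perm g) x) - h (act (inverse_perm g0) x)) < e / 2"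
    using orbit_continuousD[OF h(1) g0 e2] by blast
  have "L2_norm M (\<lambda>x. (f (act (inverse_perm g) x) + h (act (inverse_perm g) x))
      - (f (act (inverse_perm g0) x) + h (act (inverse_perm g0) x))) < e"
    if "g \<in> U \<inter> V" for g
  proof -
    have g: "g \<in> G" using openin_perm_subset[OF U(1)] that by blast
    note sq = square_integrable_act[OF perm_group_simps(3)[OF g]]
      square_integrable_act[OF perm_group_simps(3)[OF g0]]
    have "L2_norm M (\<lambda>x. (f (act (inverse_perm g) x) - f (act (inverse_perm g0) x))
        + (h (act (inverse_perm g) x) - h (act (inverse_perm g0) x))) < e"
      using L2_norm_triangle[OF square_integrable_diff[OF sq(1,2)[OF f(2)]]
          square_integrable_diff[OF sq(1,2)[OF h(2)]]] ltU[of g] ltV[of g] that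
      by simp
    then show ?thesis by (simp only: add_diff_add)
  qed
  with openin_Int[OF U(1) V(1)] U(2) V(2)
  show "\<exists>U. openin (perm_topology \<Omega> G) U \<and> g0 \<in> U \<and>
      (\<forall>g\<in>U. L2_norm M (\<lambda>x. (f (act (inverse_perm g) x) + h (act (inverse_perm g) x))
        - (f (act (inverse_perm g0) x) + h (act (inverse_perm g0) x))) < e)"
    by (intro exI[of _ "U \<inter> V"]) blast
qed

text \<open>Translations are isometries of \<open>L\<^sup>2\<close>, so an approximation of \<open>f\<close> approximates all of its
  translates equally well.\<close>

lemma orbit_continuous_limit:
  assumes f: "square_integrable M f"
    and lim: "\<And>e. 0 < e \<Longrightarrow> \<exists>h. square_integrable M h \<and> orbit_continuous h \<and> L2_norm M (\<lambda>x. f x - h x) < e"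
  shows "orbit_continuous f"
  unfolding orbit_continuous_def
proof (intro ballI allI impI)
  fix g0 and e :: real assume g0: "g0 \<in> G" and e: "0 < e"
  then have e3: "0 < e / 3" by simp
  obtain h where h: "square_integrable M h" "orbit_continuous h" "L2_norm M (\<lambda>x. f x - h x) < e / 3"
    using lim[OF e3] by blast
  obtain U where U: "openin (perm_topology \<Omega> G) U" "g0 \<in> U"
    and lt: "\<And>g. g \<in> U \<Longrightarrow> L2_norm M (\<lambda>x. h (act (inverse_perm g) x) - h (act (inverse_perm g0) x)) < e / 3"
    using orbit_continuousD[OF h(2) g0 e3] by blast
  have fh: "square_integrable M (\<lambda>x. f x - h x)" by (rule square_integrable_diff[OF f h(1)])
  have near: "L2_norm M (\<lambda>x. f (act (inverse_perm g) x) - h (act (inverse_perm g) x)) < e / 3"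
    if "g \<in> G" for g
    using L2_norm_compose[OF act_measurable[OF perm_group_simps(3)[OF that]] act_distr[OF perm_group_simps(3)[OF that]],
        of "\<lambda>x. f x - h x"] h(3) fh
    by (simp add: square_integrable_def)
  have "L2_norm M (\<lambda>x. f (act (inverse_perm g) x) - f (act (inverse_perm g0) x)) < e" if "g \<in> U" for g
  proof -
    have g: "g \<in> G" using openin_perm_subset[OF U(1)] that by blast
    note sg = square_integrable_act[OF perm_group_simps(3)[OF g]]
      and sg0 = square_integrable_act[OF perm_group_simps(3)[OF g0]]
    let ?a = "\<lambda>x. f (act (inverse_perm g) x) - h (act (inverse_perm g) x)"
    let ?b = "\<lambda>x. h (act (inverse_perm g) x) - h (act (inverse_perm g0) x)"
    let ?c = "\<lambda>x. h (act (inverse_perm g0) x) - f (act (inverse_perm g0) x)"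
    have sq: "square_integrable M ?a" "square_integrable M ?b" "square_integrable M ?c"
      by (intro square_integrable_diff sg sg0 f h(1))+
    have "L2_norm M (\<lambda>x. (?a x + ?b x) + ?c x) \<le> (L2_norm M ?a + L2_norm M ?b) + L2_norm M ?c"
      using L2_norm_triangle[OF square_integrable_add[OF sq(1,2)] sq(3)] L2_norm_triangle[OF sq(1,2)]
      by linarith
    moreover have "L2_norm M ?c < e / 3"
      using near[OF g0] by (subst L2_norm_minus_commute)
    ultimately have "L2_norm M (\<lambda>x. (?a x + ?b x) + ?c x) < e"
      using near[OF g] lt[OF that] by linarith
    then show ?thesis by simp
  qed
  with U show "\<exists>U. openin (perm_topology \<Omega> G) U \<and> g0 \<in> U \<and>
      (\<forall>g\<in>U. L2_norm M (\<lambda>x. f (act (inverse_perm g) x) - f (act (inverse_perm g0) x)) < e)"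
    by blast
qed

lemma orbit_continuous_simple_function:
  assumes s: "simple_function M s" "square_integrable M s"
  shows "orbit_continuous s"
proof -
  define t where "t = (\<lambda>D x. \<Sum>y\<in>D. y * indicator (s -` {y} \<inter> space M) x)"
  have sets: "s -` {y} \<inter> space M \<in> sets M" for y
    using simple_functionD(2)[OF s(1)] .
  have *: "square_integrable M (t D) \<and> orbit_continuous (t D)" if "finite D" for D
    using that
  proof induction
    case empty
    have "orbit_continuous (\<lambda>x. 0)"
      using orbit_continuous_cmult[OF orbit_continuous_indicator[OF sets.empty_sets], of 0] by simp
    then show ?case by (simp add: t_def square_integrable_zero)
  next
    case (insert y D)
    have eq: "t (insert y D) = (\<lambda>x. y * indicator (s -` {y} \<inter> space M) x + t D x)"
      by (simp only: t_def sum.insert[OF insert.hyps])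
    show ?case
      unfolding eq using insert.IH sets[of y]
      by (intro conjI square_integrable_add orbit_continuous_add square_integrable_cmult
          orbit_continuous_cmult square_integrable_indicator orbit_continuous_indicator) auto
  qed
  have "s x = t (s ` space M) x" if "x \<in> space M" for x
    unfolding t_def
    by (rule trans[OF simple_function_indicator_representation_banach[OF s(1) that]])
      (intro sum.cong refl, simp add: indicator_def)
  \<comment> \<open>So \<open>s\<close> is at \<open>L\<^sup>2\<close>-distance \<open>0\<close> from a linear combination of indicators.\<close>
  then have "AE x in M. s x - t (s ` space M) x = 0"
    by (intro AE_I2) simp
  then have "L2_norm M (\<lambda>x. s x - t (s ` space M) x) = 0"
    using L2_norm_eq_0_iff[OF square_integrable_diff[OF s(2)]] * simple_functionD(1)[OF s(1)] by blast
  then show ?thesis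
    using *[OF simple_functionD(1)[OF s(1)]]
    by (intro orbit_continuous_limit[OF s(2)] exI[of _ "t (s ` space M)"]) simp
qed

lemma orbit_continuous_square_integrable:
  assumes "square_integrable M f"
  shows "orbit_continuous f"
  using L2_simple_function_approximation[OF assms] orbit_continuous_simple_function
  by (intro orbit_continuous_limit[OF assms]) blast

lemma koopman_strongly_continuous:
  assumes u: "u \<in> carrier (L2 M)"
  shows "continuous_map (perm_topology \<Omega> G) (Metric_space.mtopology (carrier (L2 M)) (ip_dist (L2 M)))
    (\<lambda>g. koopman \<Omega> M \<alpha> g u)"
proof -
  interpret L: Metric_space "carrier (L2 M)" "ip_dist (L2 M)" by (rule Metric_space_L2)
  obtain f where f: "square_integrable M f" "u = L2_class M f" by (rule L2_carrierE[OF u])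
  have "\<exists>U. openin (perm_topology \<Omega> G) U \<and> g0 \<in> U \<and> (\<forall>g\<in>U. koopman \<Omega> M \<alpha> g u \<in> L.mball (koopman \<Omega> M \<alpha> g0 u) e)"
    if g0: "g0 \<in> G" and e: "0 < e" for g0 e
  proof -
    obtain U where U: "openin (perm_topology \<Omega> G) U" "g0 \<in> U"
      and lt: "\<And>g. g \<in> U \<Longrightarrow> L2_norm M (\<lambda>x. f (act (inverse_perm g) x) - f (act (inverse_perm g0) x)) < e"
      using orbit_continuousD[OF orbit_continuous_square_integrable[OF f(1)] g0 e] by blast
    have "koopman \<Omega> M \<alpha> g u \<in> L.mball (koopman \<Omega> M \<alpha> g0 u) e" if "g \<in> U" for g
    proof -
      have g: "g \<in> G" using openin_perm_subset[OF U(1)] that by blast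
      have "ip_dist (L2 M) (koopman \<Omega> M \<alpha> g u) (koopman \<Omega> M \<alpha> g0 u)
          = L2_norm M (\<lambda>x. f (act (inverse_perm g) x) - f (act (inverse_perm g0) x))"
        unfolding f(2) koopman_class[OF g f(1)] koopman_class[OF g0 f(1)]
        by (intro ip_dist_L2_class square_integrable_act perm_group_simps(3) g g0 f(1))
      then show ?thesis
        using lt[OF that] koopman_carrier[OF g u] koopman_carrier[OF g0 u] by (simp add: L.commute)
    qed
    with U show ?thesis by blast
  qed
  then show ?thesis
    using koopman_carrier[OF _ u]
    by (auto simp: L.continuous_map_to_metric)
qed

theorem unitary_representation_koopman:
  "unitary_representation \<Omega> G (L2 M) (koopman \<Omega> M \<alpha>)"
  by (intro unitary_representation.intro unitary_representation_axioms.intro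
      closed_permutation_group_axioms complex_hilbert_space_L2 koopman_hom koopman_strongly_continuous)

end

section \<open>Invariant functions and fixed vectors\<close>

text \<open>The difference \<open>d\<close> of two candidates is orthogonal to \<open>S\<close>, hence to both candidates and to
  itself, so it vanishes. Existence is not automatic: the candidate is given, and below it comes from
  conditional expectation.\<close>

lemma (in complex_hilbert_space) orthogonal_projection_eqI:
  assumes S: "S \<subseteq> carrier H" and u: "u \<in> carrier H" and v: "v \<in> S"
    and orth: "\<And>w. w \<in> S \<Longrightarrow> ip H (u \<ominus> v) w = 0"
  shows "orthogonal_projection H S u = v"
  unfolding orthogonal_projection_def
proof (rule the_equality)
  show "v \<in> S \<and> (\<forall>w\<in>S. ip H (u \<ominus> v) w = 0)" using v orth by blast
next
  fix v' assume v': "v' \<in> S \<and> (\<forall>w\<in>S. ip H (u \<ominus> v') w = 0)"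
  have vC: "v \<in> carrier H" "v' \<in> carrier H" using v v' S by auto
  define d where "d = v \<ominus> v'"
  have d: "d \<in> carrier H" unfolding d_def using vC by simp
  have split: "u \<ominus> v' = (u \<ominus> v) \<oplus> d"
    using u vC by (simp add: d_def M.minus_eq M.add.m_assoc) (simp add: M.r_neg2 M.r_neg1)
  have orth_d: "ip H d w = 0" if "w \<in> S" for w
  proof -
    have "ip H (u \<ominus> v') w = ip H (u \<ominus> v) w + ip H d w"
      unfolding split using that S u vC d by (intro ip_add_left) auto
    then show ?thesis using orth[OF that] v' that by simp
  qed
  have v_eq: "v = d \<oplus> v'" using vC by (simp add: d_def M.minus_eq M.add.m_assoc M.l_neg)
  then have "ip H v d = ip H d d + ip H v' d"
    using ip_add_left[OF d vC(2) d] by simp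
  moreover have "ip H v d = 0" "ip H v' d = 0"
    using orth_d v v' ip_cnj[OF d vC(1)] ip_cnj[OF d vC(2)] by auto
  ultimately have "d = \<zero>" using ip_pos[OF d] by force
  then show "v' = v" using v_eq vC by simp
qed

context boolean_pmp_action
begin

lemma aut_image_null_iff:
  assumes g: "g \<in> G" and Y: "Y \<in> sets M"
  shows "measure M (sym_diff (aut_image (\<alpha> g) Y) Y) = 0 \<longleftrightarrow> (AE x in M. act g x \<in> Y \<longleftrightarrow> x \<in> Y)"
proof -
  have ig: "inverse_perm g \<in> G" by (rule perm_group_simps(3)[OF g])
  have "sym_diff (aut_image (\<alpha> g) Y) Y \<in> sets M"
    using aut_image_sets[OF g Y] Y by auto
  then have "measure M (sym_diff (aut_image (\<alpha> g) Y) Y) = 0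
      \<longleftrightarrow> (AE x in M. x \<notin> sym_diff (aut_image (\<alpha> g) Y) Y)"
    by (rule prob_eq_0)
  also have "\<dots> \<longleftrightarrow> (AE x in M. x \<in> aut_image (\<alpha> g) Y \<longleftrightarrow> x \<in> Y)"
    by (intro eventually_cong) auto
  also have "\<dots> \<longleftrightarrow> (AE x in M. act (inverse_perm g) x \<in> Y \<longleftrightarrow> x \<in> Y)"
    using aut_image_iff[OF g Y] by (intro eventually_cong) auto
  also have "\<dots> \<longleftrightarrow> (AE x in M. act g x \<in> Y \<longleftrightarrow> x \<in> Y)"
  proof
    assume "AE x in M. act (inverse_perm g) x \<in> Y \<longleftrightarrow> x \<in> Y"
    from AE_act[OF g this] act_inverse(2)[OF g]
    show "AE x in M. act g x \<in> Y \<longleftrightarrow> x \<in> Y" by eventually_elim auto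
  next
    assume "AE x in M. act g x \<in> Y \<longleftrightarrow> x \<in> Y"
    from AE_act[OF ig this] act_inverse(1)[OF g]
    show "AE x in M. act (inverse_perm g) x \<in> Y \<longleftrightarrow> x \<in> Y" by eventually_elim auto
  qed
  finally show ?thesis .
qed

lemma fixator_subset: "fixator G A \<subseteq> G"
  by (auto simp: fixator_def)

text \<open>Written with preimages, invariance up to null sets visibly survives complements and countable
  unions, so the generators already form a \<open>\<sigma>\<close>-algebra.\<close>

lemma sets_invariant_algebra:
  "sets (invariant_algebra A) =
    {Y \<in> sets M. \<forall>g\<in>fixator G A. AE x in M. act g x \<in> Y \<longleftrightarrow> x \<in> Y}" (is "_ = ?F")
proof -
  have "sigma_algebra (space M) ?F"
  proof (unfold sigma_algebra_iff2, intro conjI ballI allI impI)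
    show "?F \<subseteq> Pow (space M)" using sets.sets_into_space by auto
    show "{} \<in> ?F" by simp
    fix Y assume Y: "Y \<in> ?F"
    have "AE x in M. act g x \<in> space M - Y \<longleftrightarrow> x \<in> space M - Y" if g: "g \<in> fixator G A" for g
    proof -
      have "AE x in M. act g x \<in> Y \<longleftrightarrow> x \<in> Y" using Y g by blast
      with AE_space show ?thesis
      proof eventually_elim
        case (elim x)
        then show ?case using act_space[of g x] g fixator_subset by blast
      qed
    qed
    then show "space M - Y \<in> ?F" using Y by auto
  next
    fix Y :: "nat \<Rightarrow> 'x set" assume Y: "range Y \<subseteq> ?F"
    have "AE x in M. act g x \<in> (\<Union>i. Y i) \<longleftrightarrow> x \<in> (\<Union>i. Y i)" if g: "g \<in> fixator G A" for g
    proof -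
      have "AE x in M. act g x \<in> Y i \<longleftrightarrow> x \<in> Y i" for i using Y g by blast
      then have "AE x in M. \<forall>i. act g x \<in> Y i \<longleftrightarrow> x \<in> Y i" by (simp add: AE_all_countable)
      then show ?thesis by eventually_elim blast
    qed
    then show "(\<Union>i. Y i) \<in> ?F" using Y by blast
  qed
  moreover have "{Y \<in> sets M. \<forall>g\<in>fixator G A. measure M (sym_diff (aut_image (\<alpha> g) Y) Y) = 0} = ?F"
    using aut_image_null_iff fixator_subset by blast
  ultimately show ?thesis
    unfolding invariant_algebra_def by (simp add: sigma_algebra.sets_measure_of_eq)
qed

lemma space_invariant_algebra: "space (invariant_algebra A) = space M"
  unfolding invariant_algebra_def using sets.sets_into_space by (intro space_measure_of) auto

lemma subalgebra_invariant_algebra: "Conditional_Expectation.subalgebra M (invariant_algebra A)"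
  by (auto simp: Conditional_Expectation.subalgebra_def space_invariant_algebra sets_invariant_algebra)

lemma subalgebra_invariant_algebra_mono:
  assumes "A \<subseteq> B"
  shows "Conditional_Expectation.subalgebra (invariant_algebra B) (invariant_algebra A)"
proof -
  have "fixator G B \<subseteq> fixator G A" using assms by (auto simp: fixator_def)
  then show ?thesis
    by (auto simp: Conditional_Expectation.subalgebra_def space_invariant_algebra sets_invariant_algebra)
qed

text \<open>One direction pulls invariance back along preimages of Borel sets. For the other one, fix a countable
  basis of the plane: almost every \<open>x\<close> has the property that \<open>f (g x)\<close> and \<open>f x\<close> lie in the same
  basic open sets, and then they are equal.\<close>

lemma measurable_invariant_algebra_iff:
  fixes f :: "'x \<Rightarrow> complex"
  assumes f: "f \<in> borel_measurable M"
  shows "f \<in> borel_measurable (invariant_algebra A) \<longleftrightarrow> (\<forall>g\<in>fixator G A. AE x in M. f (act g x) = f x)"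
proof
  assume inv: "\<forall>g\<in>fixator G A. AE x in M. f (act g x) = f x"
  show "f \<in> borel_measurable (invariant_algebra A)"
  proof (rule measurableI)
    fix C :: "complex set" assume C: "C \<in> sets borel"
    have "AE x in M. act g x \<in> f -` C \<inter> space M \<longleftrightarrow> x \<in> f -` C \<inter> space M" if "g \<in> fixator G A" for g
    proof -
      have "g \<in> G" using that fixator_subset by blast
      from inv that have "AE x in M. f (act g x) = f x" by blast
      with AE_space show ?thesis
        by eventually_elim (simp add: act_space[OF \<open>g \<in> G\<close>])
    qed
    then show "f -` C \<inter> space (invariant_algebra A) \<in> sets (invariant_algebra A)"
      using measurable_sets[OF f C] by (simp add: space_invariant_algebra sets_invariant_algebra)
  qed simp
next
  assume fA: "f \<in> borel_measurable (invariant_algebra A)"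
  obtain B :: "complex set set" where B: "countable B" "topological_basis B"
    using ex_countable_basis by blast
  show "\<forall>g\<in>fixator G A. AE x in M. f (act g x) = f x"
  proof
    fix g assume g: "g \<in> fixator G A"
    then have "g \<in> G" using fixator_subset by blast
    have "AE x in M. f (act g x) \<in> U \<longleftrightarrow> f x \<in> U" if "U \<in> B" for U
    proof -
      have "U \<in> sets borel" using topological_basis_open[OF B(2) that] by simp
      then have "f -` U \<inter> space M \<in> sets (invariant_algebra A)"
        using measurable_sets[OF fA] by (simp add: space_invariant_algebra)
      then have "AE x in M. act g x \<in> f -` U \<inter> space M \<longleftrightarrow> x \<in> f -` U \<inter> space M"
        using g by (simp only: sets_invariant_algebra) blast
      with AE_space show ?thesis
        by eventually_elim (simp add: act_space[OF \<open>g \<in> G\<close>])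
    qed
    then have "AE x in M. \<forall>U\<in>B. f (act g x) \<in> U \<longleftrightarrow> f x \<in> U"
      using B(1) by (simp add: AE_ball_countable)
    then show "AE x in M. f (act g x) = f x"
    proof eventually_elim
      case (elim x)
      show ?case
      proof (rule ccontr)
        assume "f (act g x) \<noteq> f x"
        then obtain V where "open V" "f (act g x) \<in> V" "f x \<notin> V" using t1_space by blast
        then show False using elim topological_basisE[OF B(2)] by (metis subsetD)
      qed
    qed
  qed
qed

section \<open>Comparison of the two notions of dissociation\<close>

interpretation K: unitary_representation \<Omega> G "L2 M" "koopman \<Omega> M \<alpha>"
  by (rule unitary_representation_koopman)

lemma L2_class_in_fixed_space_iff:
  assumes f: "square_integrable M f"
  shows "L2_class M f \<in> K.fixed_space A \<longleftrightarrow> f \<in> borel_measurable (invariant_algebra A)"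
proof -
  have "koopman \<Omega> M \<alpha> g (L2_class M f) = L2_class M f \<longleftrightarrow> (AE x in M. f (act g x) = f x)"
    if "g \<in> fixator G A" for g
  proof -
    have g: "g \<in> G" using that fixator_subset by blast
    then have ig: "inverse_perm g \<in> G" by (rule perm_group_simps(3))
    have "koopman \<Omega> M \<alpha> g (L2_class M f) = L2_class M f
        \<longleftrightarrow> (AE x in M. f (act (inverse_perm g) x) = f x)"
      unfolding koopman_class[OF g f]
      by (rule L2_class_eq_iff[OF square_integrable_act[OF ig f] f])
    also have "\<dots> \<longleftrightarrow> (AE x in M. f (act g x) = f x)"
    proof
      assume "AE x in M. f (act (inverse_perm g) x) = f x"
      from AE_act[OF g this] act_inverse(2)[OF g]
      show "AE x in M. f (act g x) = f x" by eventually_elim simp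
    next
      assume "AE x in M. f (act g x) = f x"
      from AE_act[OF ig this] act_inverse(1)[OF g]
      show "AE x in M. f (act (inverse_perm g) x) = f x" by eventually_elim simp
    qed
    finally show ?thesis .
  qed
  moreover have "f \<in> borel_measurable M" using f by (simp add: square_integrable_def)
  ultimately show ?thesis
    using f by (simp add: K.fixed_space_def L2_class_in_carrier measurable_invariant_algebra_iff)
qed

text \<open>\<open>E[f | F\<^sub>A]\<close> is \<open>F\<^sub>A\<close>-measurable, hence a fixed vector, and the remainder \<open>f - E[f | F\<^sub>A]\<close> is
  orthogonal to all \<open>F\<^sub>A\<close>-measurable functions, hence to all fixed vectors.\<close>

lemma fixed_proj_class:
  assumes f: "square_integrable M f"
  shows "K.fixed_proj A (L2_class M f) = L2_class M (complex_cond_exp M (invariant_algebra A) f)"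
  unfolding K.fixed_proj_def
proof (rule K.orthogonal_projection_eqI)
  let ?E = "complex_cond_exp M (invariant_algebra A) f"
  note sub = subalgebra_invariant_algebra[of A]
  have E: "square_integrable M ?E" by (rule square_integrable_complex_cond_exp[OF sub f])
  show "K.fixed_space A \<subseteq> carrier (L2 M)" by (auto simp: K.fixed_space_def)
  show "L2_class M f \<in> carrier (L2 M)" by (rule L2_class_in_carrier[OF f])
  show "L2_class M ?E \<in> K.fixed_space A"
    unfolding L2_class_in_fixed_space_iff[OF E] by (rule borel_measurable_complex_cond_exp)
  fix w assume w: "w \<in> K.fixed_space A"
  then have "w \<in> carrier (L2 M)" by (simp add: K.fixed_space_def)
  then obtain k where k: "square_integrable M k" "w = L2_class M k" by (rule L2_carrierE)
  then have "k \<in> borel_measurable (invariant_algebra A)"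
    using w L2_class_in_fixed_space_iff by blast
  from complex_cond_exp_orthogonal[OF sub f k(1) this]
  show "ip (L2 M) (L2_class M f \<ominus>\<^bsub>L2 M\<^esub> L2_class M ?E) w = 0"
    unfolding k(2) L2_minus_class[OF f E] L2_ip_class[OF square_integrable_diff[OF f E] k(1)] .
qed

text \<open>With \<open>p\<^sub>A = E[ _ | F\<^sub>A]\<close>, the condition on the action reads \<open>p\<^sub>A f = p\<^bsub>A \<inter> B\<^esub> f\<close> for all \<open>f\<close> in
  the range of \<open>p\<^sub>B\<close>. It turns into \<open>p\<^sub>A p\<^sub>B = p\<^bsub>A \<inter> B\<^esub>\<close> because \<open>p\<^bsub>A \<inter> B\<^esub> p\<^sub>B = p\<^bsub>A \<inter> B\<^esub>\<close> by the
  tower property, and because \<open>p\<^sub>B f = f\<close> for \<open>F\<^sub>B\<close>-measurable \<open>f\<close>.\<close>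

theorem dissociated_iff_koopman_dissociated: "dissociated \<longleftrightarrow> K.dissociated"
proof
  assume D: dissociated
  show K.dissociated
    unfolding K.dissociated_def
  proof (intro allI impI ballI)
    fix A B u assume AB: "finite A" "A \<subseteq> \<Omega>" "finite B" "B \<subseteq> \<Omega>" and u: "u \<in> carrier (L2 M)"
    obtain f where f: "square_integrable M f" "u = L2_class M f" by (rule L2_carrierE[OF u])
    let ?E = "\<lambda>C. complex_cond_exp M (invariant_algebra C)"
    note sq = square_integrable_complex_cond_exp[OF subalgebra_invariant_algebra]
    have "AE x in M. ?E A (?E B f) x = ?E (A \<inter> B) (?E B f) x"
      using D AB sq[OF f(1)] borel_measurable_complex_cond_exp[of M "invariant_algebra B" f]
      unfolding dissociated_def by blast
    moreover have "AE x in M. ?E (A \<inter> B) (?E B f) x = ?E (A \<inter> B) f x"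
      by (intro complex_cond_exp_nested subalgebra_invariant_algebra subalgebra_invariant_algebra_mono f(1)) simp
    ultimately have "AE x in M. ?E A (?E B f) x = ?E (A \<inter> B) f x"
      by eventually_elim simp
    then have "L2_class M (?E A (?E B f)) = L2_class M (?E (A \<inter> B) f)"
      by (intro L2_class_eq_iff[THEN iffD2] sq f(1))
    then show "K.fixed_proj A (K.fixed_proj B u) = K.fixed_proj (A \<inter> B) u"
      unfolding f(2) fixed_proj_class[OF f(1)] fixed_proj_class[OF sq[OF f(1)]] .
  qed
next
  assume D: K.dissociated
  show dissociated
    unfolding dissociated_def
  proof (intro allI impI)
    fix A B and f :: "'x \<Rightarrow> complex"
    assume AB: "finite A" "A \<subseteq> \<Omega>" "finite B" "B \<subseteq> \<Omega>"
      and fB: "f \<in> borel_measurable (invariant_algebra B)" and f: "square_integrable M f"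
    let ?E = "\<lambda>C. complex_cond_exp M (invariant_algebra C)"
    note sq = square_integrable_complex_cond_exp[OF subalgebra_invariant_algebra f]
    have "L2_class M (?E B f) = L2_class M f"
      using complex_cond_exp_measurable_eq[OF subalgebra_invariant_algebra f fB]
      by (rule L2_class_eq_iff[OF sq f, THEN iffD2])
    moreover have "K.fixed_proj A (K.fixed_proj B (L2_class M f)) = K.fixed_proj (A \<inter> B) (L2_class M f)"
      using D AB L2_class_in_carrier[OF f] unfolding K.dissociated_def by blast
    ultimately have "L2_class M (?E A f) = L2_class M (?E (A \<inter> B) f)"
      by (simp only: fixed_proj_class[OF f])
    then show "AE x in M. ?E A f x = ?E (A \<inter> B) f x"
      by (rule L2_class_eq_iff[OF sq sq, THEN iffD1])
  qed
qed

end

theorem lemma1p3: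
  fixes \<Omega> :: "'w set" and G :: "('w \<Rightarrow> 'w) set"
    and M :: "'x measure" and \<alpha> :: "('w \<Rightarrow> 'w) \<Rightarrow> ('x \<Rightarrow> 'x) set"
  assumes "countable \<Omega>" and "infinite \<Omega>"
    and "closed_permutation_group \<Omega> G"
    and "standard_prob_space M"
    and "boolean_pmp_action \<Omega> G M \<alpha>"
  shows "boolean_pmp_action.dissociated \<Omega> G M \<alpha> \<longleftrightarrow>
         unitary_representation.dissociated \<Omega> G (L2 M) (koopman \<Omega> M \<alpha>)"
  by (rule boolean_pmp_action.dissociated_iff_koopman_dissociated[OF assms(5)])

end
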